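(* Let $(\boldsymbol{X}_1,Y_1),\dots,(\boldsymbol{X}_n,Y_n)$ be independent and identically distributed copies of $(\boldsymbol{X},Y)$. Assume that conditions C1--C9 listed in the context hold, that the logistic regression model holds with true parameter $\boldsymbol{\beta}^*$, and that $\boldsymbol{\beta}^*\neq\boldsymbol{\beta}_0$. Let $\phi\in\Phi$ and suppose also: (i) $E_{\boldsymbol{\beta}^*}\left[\frac{\boldsymbol{g}(\boldsymbol{X},Y,\boldsymbol{\beta}_0)}{1+\boldsymbol{\tau}^T\boldsymbol{g}(\boldsymbol{X},Y,\boldsymbol{\beta}_0)}\right]$ exists and there exists $\boldsymbol{\tau}$ being the only solution of $$E_{\boldsymbol{\beta}^*}\left[\frac{\boldsymbol{g}(\boldsymbol{X},Y,\boldsymbol{\beta}_0)}{1+\boldsymbol{\tau}^T\boldsymbol{g}(\boldsymbol{X},Y,\boldsymbol{\beta}_0)}\right]=\boldsymbol{0}_q;$$ (ii) $E_{\boldsymbol{\beta}^*}\left[\frac{-\boldsymbol{g}(\boldsymbol{X},Y,\boldsymbol{\beta}_0)\boldsymbol{g}^T(\boldsymbol{X},Y,\boldsymbol{\beta}_0)}{(1+\boldsymbol{\tau}^T\boldsymbol{g}(\boldsymbol{X},Y,\boldsymbol{\beta}_0))^2}\right]$ exists and has maximal rank; (iii) $E_{\boldsymbol{\beta}^*}\left[\frac{\boldsymbol{g}(\boldsymbol{X},Y,\boldsymbol{\beta}_0)}{1+\boldsymbol{\tau}^T\boldsymbol{g}(\boldsymbol{X},Y,\boldsymbol{\beta}_0)}\,\psi\left(1+\boldsymbol{\tau}^T\boldsymbol{g}(\boldsymbol{X},Y,\boldsymbol{\beta}_0)\right)\right]$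 exists, where $\psi(x):=-\frac1x\phi(x)+\phi'(x)$. Then, for a fixed significance level $\alpha$, the probability of rejecting $\boldsymbol{\beta}_0$ with the rejection rule $T_n^\phi(\boldsymbol{\beta}_0)>\chi^2_{q;\alpha}$ tends to 1: $$\lim_{n\to\infty}P_{\boldsymbol{\beta}^*}\left(T_n^\phi(\boldsymbol{\beta}_0)>\chi^2_{q;\alpha}\right)=1,$$ where $\chi^2_{q;\alpha}$ is the critical value of level $\alpha$ (the $(1-\alpha)$-quantile) of the chi-square distribution with $q$ degrees of freedom. Thus the test is consistent in the sense of Fraser.
   Context: Model. $\boldsymbol{X}$ is a $q$-dimensional explanatory random vector and $Y\in\{0,1\}$. The logistic regression model with parameter $\boldsymbol{\beta}\in\mathbb{R}^q$ means that $\Pr(Y_i=1)=\pi(\boldsymbol{x}_i^T\boldsymbol{\beta})$ given $\boldsymbol{X}_i=\boldsymbol{x}_i$, with $\pi(s)=e^s/(1+e^s)$. The $n\times q$ design matrix with rows $\boldsymbol{X}_i^T$ is assumed to have rank $q$. Put $\boldsymbol{g}(\boldsymbol{x},y,\boldsymbol{\beta})=\boldsymbol{x}\,(y-\pi(\boldsymbol{x}^T\boldsymbol{\beta}))\in\mathbb{R}^q$. $P_{\boldsymbol{\beta}^*}$ and $E_{\boldsymbol{\beta}^*}$ are probability and expectation when the true parameter is $\boldsymbol{\beta}^*$; $\boldsymbol{\beta}_0\in\mathbb{R}^q$ is the value in the null hypothesis $H_0:\boldsymbol{\beta}=\boldsymbol{\beta}_0$. Empirical weights. For a parameter vector $\boldsymbol{\beta}$,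 $\boldsymbol{t}(\boldsymbol{\beta})\in\mathbb{R}^q$ is the solution (unique under C2 and C3) of $$\frac1n\sum_{i=1}^n\frac{\boldsymbol{g}(\boldsymbol{X}_i,Y_i,\boldsymbol{\beta})}{1+\boldsymbol{t}^T(\boldsymbol{\beta})\boldsymbol{g}(\boldsymbol{X}_i,Y_i,\boldsymbol{\beta})}=\boldsymbol{0}_q,\qquad 1+\boldsymbol{t}^T(\boldsymbol{\beta})\boldsymbol{g}(\boldsymbol{X}_i,Y_i,\boldsymbol{\beta})\ge \tfrac1n\ \ (i=1,\dots,n).$$ Test statistic. $\Phi$ is the class of all twice differentiable convex functions $\phi:\mathbb{R}^+\to\mathbb{R}$ with $\phi(1)=0$, $\phi'(1)=0$, $\phi''(1)>0$, $0\phi(0/0)=0$ and $0\phi(p/0)=p\lim_{u\to\infty}\phi(u)/u$. The empirical phi-divergence test statistic is $$T_n^{\phi}(\boldsymbol{\beta}_0)=\frac{2}{\phi''(1)}\sum_{i=1}^n \frac{1}{1+\boldsymbol{t}^T(\boldsymbol{\beta}_0)\boldsymbol{g}(\boldsymbol{X}_i,Y_i,\boldsymbol{\beta}_0)}\,\phi\left(1+\boldsymbol{t}^T(\boldsymbol{\beta}_0)\boldsymbol{g}(\boldsymbol{X}_i,Y_i,\boldsymbol{\beta}_0)\right).$$ Conditions (the true parameter is $\boldsymbol{\beta}^*$; where no value is specified, $\boldsymbol{\beta}$ is the parameter vector under consideration): C1: the true parameter is the only solution of $E[\boldsymbol{g}(\boldsymbol{X},Y,\boldsymbol{\beta})]=\boldsymbol{0}_q$.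 C2: the null vector is contained in the convex hull of $\boldsymbol{g}(\boldsymbol{X}_i,Y_i,\boldsymbol{\beta})$, $i=1,\dots,n$. C3: the matrix $\sum_{i=1}^n\boldsymbol{g}(\boldsymbol{X}_i,Y_i,\boldsymbol{\beta})\boldsymbol{g}(\boldsymbol{X}_i,Y_i,\boldsymbol{\beta})^T$ is positive definite. C4: the matrix $E[\boldsymbol{g}(\boldsymbol{X}_i,Y_i,\boldsymbol{\beta})\boldsymbol{g}^T(\boldsymbol{X}_i,Y_i,\boldsymbol{\beta})]$ is positive definite. C5: $\partial\boldsymbol{g}(\boldsymbol{X}_i,Y_i,\boldsymbol{\beta})/\partial\boldsymbol{\beta}$ is continuous in a neighborhood of the true parameter. C6: $\|\partial\boldsymbol{g}(\boldsymbol{X}_i,Y_i,\boldsymbol{\beta})/\partial\boldsymbol{\beta}\|$ and $\|\boldsymbol{g}(\boldsymbol{X}_i,Y_i,\boldsymbol{\beta})\|^3$ are bounded by some integrable function $G_1(\boldsymbol{X}_i,Y_i)$ in a neighborhood of the true parameter. C7: the rank of $E[\partial\boldsymbol{g}(\boldsymbol{X}_i,Y_i,\boldsymbol{\beta})/\partial\boldsymbol{\beta}]$ is $q$. C8: $\partial^2\boldsymbol{g}(\boldsymbol{X}_i,Y_i,\boldsymbol{\beta})/\partial\boldsymbol{\beta}\,\partial\boldsymbol{\beta}^T$ is continuous in a neighborhood of the true parameter. C9: $\|\partial^2\boldsymbol{g}(\boldsymbol{X}_i,Y_i,\boldsymbol{\beta})/\partial\boldsymbol{\beta}\,\partial\boldsymbol{\beta}^T\|$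 is bounded by some integrable function $G_2(\boldsymbol{X}_i,Y_i)$ in a neighborhood of the true parameter. *)

theory Defs
  imports "HOL-Probability.Probability"
begin

section \<open>Logistic regression and its estimating function\<close>

definition logistic :: "real \<Rightarrow> real" where
  "logistic s = exp s / (1 + exp s)"

definition score :: "real ^ 'q \<Rightarrow> real \<Rightarrow> real ^ 'q \<Rightarrow> real ^ 'q" where
  "score x y b = (y - logistic (x \<bullet> b)) *\<^sub>R x"

definition score_jac :: "real ^ 'q \<Rightarrow> real \<Rightarrow> real ^ 'q \<Rightarrow> real ^ 'q ^ 'q" where
  "score_jac x y b = jacobian (score x y) (at b)"

text \<open>
  The array of second partial derivatives: its \<open>k\<close>-th slice is the Hessian matrix of the
  \<open>k\<close>-th component of the estimating function. The norm on this type is the Euclidean one.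
\<close>
definition score_hess :: "real ^ 'q \<Rightarrow> real \<Rightarrow> real ^ 'q \<Rightarrow> real ^ 'q ^ 'q ^ 'q" where
  "score_hess x y b = (\<chi> k. jacobian (\<lambda>c. score_jac x y c $ k) (at b))"

text \<open>\<open>Pr(Y = 1 | X) = logistic (X \<bullet> b)\<close>, almost surely.\<close>
definition logistic_model ::
  "'w measure \<Rightarrow> ('w \<Rightarrow> real ^ 'q) \<Rightarrow> ('w \<Rightarrow> real) \<Rightarrow> real ^ 'q \<Rightarrow> bool" where
  "logistic_model M X Y b \<longleftrightarrow>
     (AE w in M. real_cond_exp M (vimage_algebra (space M) X borel)
                   (\<lambda>w. indicator {1} (Y w)) w = logistic (X w \<bullet> b))"

definition outer :: "real ^ 'q \<Rightarrow> real ^ 'q ^ 'q" where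
  "outer v = (columnvector v :: real ^ 1 ^ 'q) ** (rowvector v :: real ^ 'q ^ 1)"

definition posdef :: "real ^ 'q ^ 'q \<Rightarrow> bool" where
  "posdef A \<longleftrightarrow> transpose A = A \<and> (\<forall>v. v \<noteq> 0 \<longrightarrow> 0 < v \<bullet> (A *v v))"


section \<open>Empirical phi-divergence test statistic\<close>

text \<open>
  The conventions \<open>0 \<phi>(0/0) = 0\<close> and \<open>0 \<phi>(p/0) = p lim \<phi>(u)/u\<close> concern the notation
  \<open>r \<phi>(p/r)\<close> at \<open>r = 0\<close> and do not restrict \<open>\<phi>\<close>. They are not needed below, where \<open>\<phi>\<close> is only
  evaluated at positive arguments. Values of \<open>\<phi>\<close> outside the positive half-line are irrelevant.
\<close>
definition Phi :: "(real \<Rightarrow> real) set" where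
  "Phi = {\<phi>. convex_on {0<..} \<phi> \<and>
             (\<forall>x>0. \<phi> differentiable (at x)) \<and>
             (\<forall>x>0. deriv \<phi> differentiable (at x)) \<and>
             \<phi> 1 = 0 \<and> deriv \<phi> 1 = 0 \<and> deriv (deriv \<phi>) 1 > 0}"

definition psi :: "(real \<Rightarrow> real) \<Rightarrow> real \<Rightarrow> real" where
  "psi \<phi> x = - (1 / x) * \<phi> x + deriv \<phi> x"

text \<open>In the following, \<open>g i\<close> stands for the value of the estimating function at the \<open>i\<close>-th
  observation, with observations numbered from \<open>0\<close>.\<close>

definition el_solution :: "nat \<Rightarrow> (nat \<Rightarrow> real ^ 'q) \<Rightarrow> real ^ 'q \<Rightarrow> bool" where
  "el_solution n g t \<longleftrightarrow>
     (1 / real n) *\<^sub>R (\<Sum>i<n. (1 / (1 + t \<bullet> g i)) *\<^sub>R g i) = 0 \<and>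
     (\<forall>i<n. 1 + t \<bullet> g i \<ge> 1 / real n)"

definition el_multiplier :: "nat \<Rightarrow> (nat \<Rightarrow> real ^ 'q) \<Rightarrow> real ^ 'q" where
  "el_multiplier n g = (THE t. el_solution n g t)"

text \<open>
  For samples in which the multiplier does not exist uniquely the statistic is mathematically
  undefined; it is given the value \<open>0\<close> there, so that such samples never count as rejections.
\<close>
definition phi_stat :: "(real \<Rightarrow> real) \<Rightarrow> nat \<Rightarrow> (nat \<Rightarrow> real ^ 'q) \<Rightarrow> real" where
  "phi_stat \<phi> n g =
     (if \<exists>!t. el_solution n g t
      then 2 / deriv (deriv \<phi>) 1 *
           (\<Sum>i<n. 1 / (1 + el_multiplier n g \<bullet> g i) * \<phi> (1 + el_multiplier n g \<bullet> g i))
      else 0)"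


section \<open>Chi-square critical values\<close>

definition chi_square_density :: "nat \<Rightarrow> real \<Rightarrow> real" where
  "chi_square_density q x =
     (if x > 0 then x powr (real q / 2 - 1) * exp (- x / 2) / (2 powr (real q / 2) * Gamma (real q / 2))
      else 0)"

definition chi_square :: "nat \<Rightarrow> real measure" where
  "chi_square q = density lborel (\<lambda>x. ennreal (chi_square_density q x))"

definition chi_square_crit :: "nat \<Rightarrow> real \<Rightarrow> real" where
  "chi_square_crit q \<alpha> = Inf {c. cdf (chi_square q) c \<ge> 1 - \<alpha>}"


section \<open>Population multiplier\<close>

text \<open>
  \<open>t\<close> solves \<open>E[G / (1 + t \<bullet> G)] = 0\<close>. The expectation exists when the integrand is defined almost
  surely (this has to be said since \<open>x / 0 = 0\<close> here) and is integrable.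
\<close>
definition pop_solution :: "'w measure \<Rightarrow> ('w \<Rightarrow> real ^ 'q) \<Rightarrow> real ^ 'q \<Rightarrow> bool" where
  "pop_solution M G t \<longleftrightarrow>
     (AE w in M. 1 + t \<bullet> G w \<noteq> 0) \<and>
     integrable M (\<lambda>w. (1 / (1 + t \<bullet> G w)) *\<^sub>R G w) \<and>
     integral\<^sup>L M (\<lambda>w. (1 / (1 + t \<bullet> G w)) *\<^sub>R G w) = 0"

end

theory Submission
  imports Defs
begin

text \<open>
  With \<open>G = score X Y \<beta>0\<close>, the equation \<open>E[G / (1 + \<tau> \<bullet> G)] = 0\<close> with nondegenerate \<open>G\<close> and
  \<open>1 + \<tau> \<bullet> G > 0\<close> forces \<open>v \<bullet> G > 0\<close> with positive probability for every direction \<open>v \<noteq> 0\<close>. By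
  compactness of the sphere, finitely many sets of positive probability witness this, so with
  probability tending to one the sample multiplier \<open>t\<close> exists uniquely. Consistency of \<open>t\<close> for \<open>\<tau>\<close>
  is not needed, only that \<open>t\<close> stays away from \<open>0\<close>: since \<open>t\<close> maximises the empirical
  log-likelihood,
  \<open>norm t * mean (norm G) \<ge> mean (ln (1 + t \<bullet> G)) \<ge> mean (ln (1 + \<tau> \<bullet> G)) \<rightarrow> E[ln (1 + \<tau> \<bullet> G)] > 0\<close>,
  where \<open>\<tau> \<noteq> 0\<close> because \<open>\<beta>0\<close> is not the true parameter. Hence a positive fraction of the
  observations has \<open>t \<bullet> G\<close> bounded away from \<open>0\<close>, where \<open>\<phi> u / u\<close> is bounded below, and the statistic
  grows linearly in \<open>n\<close>. All laws of large numbers involve square integrable variables, so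
  Chebyshev's inequality suffices.
\<close>


section \<open>The empirical likelihood multiplier\<close>

lemma el_solution_iff:
  "el_solution n g t \<longleftrightarrow>
     (\<Sum>i<n. (1 / (1 + t \<bullet> g i)) *\<^sub>R g i) = 0 \<and> (\<forall>i<n. 1 + t \<bullet> g i \<ge> 1 / real n)"
  unfolding el_solution_def by (cases "n = 0") auto

lemma el_solution_pos: "el_solution n g t \<Longrightarrow> i < n \<Longrightarrow> 0 < 1 + t \<bullet> g i"
  unfolding el_solution_iff
  by (metis divide_pos_pos gr_zeroI less_le_trans not_less_zero of_nat_0_less_iff zero_less_one)

lemma el_solution_sum_inner:
  assumes "el_solution n g t"
  shows "(\<Sum>i<n. (v \<bullet> g i) / (1 + t \<bullet> g i)) = 0"
proof -
  have "(\<Sum>i<n. (v \<bullet> g i) / (1 + t \<bullet> g i)) = v \<bullet> (\<Sum>i<n. (1 / (1 + t \<bullet> g i)) *\<^sub>R g i)"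
    by (simp add: inner_sum_right)
  then show ?thesis using assms by (simp add: el_solution_iff)
qed

text \<open>The bound \<open>1/n\<close> costs nothing: at a stationary point the weights \<open>1/(n(1 + t \<bullet> g i))\<close>
  are nonnegative and add up to one.\<close>
lemma el_solutionI:
  assumes pos: "\<And>i. i < n \<Longrightarrow> 0 < 1 + t \<bullet> g i"
    and stat: "\<And>v. (\<Sum>i<n. (v \<bullet> g i) / (1 + t \<bullet> g i)) = 0"
  shows "el_solution n g t"
proof -
  let ?S = "\<Sum>i<n. (1 / (1 + t \<bullet> g i)) *\<^sub>R g i"
  \<comment> \<open>Taking \<open>v = ?S\<close> turns the scalar equations into the vanishing of a
    squared norm.\<close>
  have "?S \<bullet> ?S = (\<Sum>i<n. (?S \<bullet> g i) / (1 + t \<bullet> g i))"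
    by (subst inner_sum_right) simp
  then have S: "?S = 0" using stat by simp
  have "1 / real n \<le> 1 + t \<bullet> g i" if "i < n" for i
  proof -
    have "1 / (1 + t \<bullet> g i) \<le> (\<Sum>i<n. 1 / (1 + t \<bullet> g i))"
      using that pos by (intro member_le_sum) (auto intro: less_imp_le)
    \<comment> \<open>Stationarity in the direction \<open>t\<close> adds zero and turns each
      summand into \<open>1\<close>.\<close>
    also have "\<dots> = (\<Sum>i<n. 1 / (1 + t \<bullet> g i) + (t \<bullet> g i) / (1 + t \<bullet> g i))"
      using stat[of t] by (simp add: sum.distrib)
    also have "\<dots> = (\<Sum>i<n. 1)"
      using pos by (intro sum.cong refl) (simp add: add_divide_distrib[symmetric] less_imp_neq[symmetric])
    finally have "1 / (1 + t \<bullet> g i) \<le> real n" by simp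
    then show ?thesis using pos[OF that] that
      by (simp add: field_simps)
  qed
  with S show ?thesis by (auto simp: el_solution_iff)
qed

text \<open>Testing both stationarity equations with \<open>t - s\<close> and subtracting leaves a
  sum of squares over positive denominators, and one observation makes it strictly positive.\<close>

lemma el_solution_unique:
  assumes t: "el_solution n g t" and s: "el_solution n g s"
    and pos: "\<And>v. v \<noteq> 0 \<Longrightarrow> \<exists>i<n. 0 < v \<bullet> g i"
  shows "t = s"
proof (rule ccontr)
  assume "t \<noteq> s"
  then obtain j where j: "j < n" "0 < (t - s) \<bullet> g j"
    using pos[of "t - s"] by auto
  let ?a = "\<lambda>i. 1 + t \<bullet> g i" and ?b = "\<lambda>i. 1 + s \<bullet> g i"
  have ab: "0 < ?a i" "0 < ?b i" if "i < n" for i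
    using el_solution_pos[OF t that] el_solution_pos[OF s that] by auto
  have "0 = (\<Sum>i<n. ((t - s) \<bullet> g i) / ?b i - ((t - s) \<bullet> g i) / ?a i)"
    using el_solution_sum_inner[OF t, of "t - s"] el_solution_sum_inner[OF s, of "t - s"]
    by (simp add: sum_subtractf)
  also have "\<dots> = (\<Sum>i<n. ((t - s) \<bullet> g i)\<^sup>2 / (?a i * ?b i))"
  proof (intro sum.cong refl)
    fix i assume "i \<in> {..<n}"
    then have "0 < ?a i" "0 < ?b i" using ab by auto
    then show "((t - s) \<bullet> g i) / ?b i - ((t - s) \<bullet> g i) / ?a i = ((t - s) \<bullet> g i)\<^sup>2 / (?a i * ?b i)"
      by (simp add: divide_simps) (simp add: inner_diff_left algebra_simps power2_eq_square)
  qed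
  also have "\<dots> > 0"
    using j ab by (intro sum_pos2[of _ j]) (auto intro!: divide_nonneg_pos)
  finally show False by simp
qed

text \<open>The multiplier maximises the product of the factors \<open>1 + t \<bullet> g i\<close>,
  which, unlike the sum of their logarithms, stays continuous where a factor vanishes. The margin
  \<open>\<eta>\<close> bounds the feasible polyhedron, so a maximiser exists.\<close>

lemma el_solution_exists:
  fixes g :: "nat \<Rightarrow> real ^ 'q"
  assumes eta: "0 < \<eta>" and pos: "\<And>v. norm v = 1 \<Longrightarrow> \<exists>i<n. \<eta> < v \<bullet> g i"
  shows "\<exists>t. el_solution n g t"
proof -
  define C where "C = {t. \<forall>i<n. 0 \<le> 1 + t \<bullet> g i}"
  define P where "P t = (\<Prod>i<n. 1 + t \<bullet> g i)" for t
  have "closed C" unfolding C_def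
    by (intro closed_Collect_all closed_Collect_imp closed_Collect_le continuous_intros open_Collect_const)
  moreover have "norm t \<le> 1 / \<eta>" if t: "t \<in> C" for t
  proof (cases "t = 0")
    case False
    \<comment> \<open>The margin in the direction opposite to \<open>t\<close> pushes some
      \<open>t \<bullet> g i\<close> below \<open>- \<eta> * norm t\<close>, while feasibility keeps
      it at least \<open>-1\<close>.\<close>
    then have "norm (- (1 / norm t) *\<^sub>R t) = 1" by simp
    from pos[OF this] obtain i where i: "i < n" "\<eta> < - (1 / norm t) * (t \<bullet> g i)"
      by auto
    then have "\<eta> * norm t < - (t \<bullet> g i)"
      using False by (simp add: field_simps)
    also have "\<dots> \<le> 1" using t i by (auto simp: C_def dest!: spec[of _ i])
    finally show ?thesis using eta by (simp add: field_simps)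
  qed (use eta in auto)
  ultimately have "compact C"
    by (auto simp: compact_eq_bounded_closed bounded_iff)
  moreover have "0 \<in> C" by (simp add: C_def)
  moreover have "continuous_on C P" unfolding P_def by (intro continuous_intros)
  ultimately obtain t where t: "t \<in> C" and max: "\<And>s. s \<in> C \<Longrightarrow> P s \<le> P t"
    using continuous_attains_sup[of C P] by blast
  \<comment> \<open>The origin is feasible with product \<open>1\<close>, so no factor vanishes at
    the maximiser.\<close>
  have "P 0 = 1" by (simp add: P_def)
  then have "0 < P t" using max[OF \<open>0 \<in> C\<close>] by simp
  have tpos: "0 < 1 + t \<bullet> g i" if "i < n" for i
  proof -
    have "1 + t \<bullet> g i \<noteq> 0"
      using \<open>0 < P t\<close> that prod_zero[of "{..<n}" "\<lambda>i. 1 + t \<bullet> g i"] unfolding P_def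
      by (metis finite_lessThan lessThan_iff less_irrefl)
    then show ?thesis using t that by (auto simp: C_def order.order_iff_strict dest!: spec[of _ i])
  qed
  \<comment> \<open>On this open set the logarithm of the product is differentiable, and its
    derivative at the maximiser \<open>t\<close> vanishes, which is stationarity.\<close>
  define D where "D = (\<Inter>i<n. {t. 0 < 1 + t \<bullet> g i})"
  have "open D" unfolding D_def
    by (intro open_INT ballI open_Collect_less continuous_intros) auto
  define f where "f s = (\<Sum>i<n. ln (1 + s \<bullet> g i))" for s
  have f_eq: "f s = ln (P s)" if "s \<in> D" for s
    unfolding f_def P_def using that by (subst ln_prod) (force simp: D_def)+
  have P_pos: "0 < P s" if "s \<in> D" for s
    unfolding P_def using that by (intro prod_pos) (auto simp: D_def)
  have tD: "t \<in> D" using tpos by (auto simp: D_def)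
  have "f s \<le> f t" if "s \<in> D" for s
  proof -
    have "s \<in> C" using that by (auto simp: C_def D_def intro: less_imp_le)
    from max[OF this] show ?thesis using P_pos[OF that] P_pos[OF tD] that tD by (simp add: f_eq)
  qed
  moreover have "(f has_derivative (\<lambda>v. \<Sum>i<n. (v \<bullet> g i) / (1 + t \<bullet> g i))) (at t)"
    unfolding f_def using tpos
    by (auto intro!: derivative_eq_intros simp: field_simps)
  ultimately have "(\<lambda>v. \<Sum>i<n. (v \<bullet> g i) / (1 + t \<bullet> g i)) = (\<lambda>v. 0)"
    using differential_zero_maxmin[OF tD \<open>open D\<close>] by blast
  then have "el_solution n g t"
    using tpos by (intro el_solutionI) meson+
  then show ?thesis ..
qed

lemma el_solution_ex1:
  fixes g :: "nat \<Rightarrow> real ^ 'q"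
  assumes eta: "0 < \<eta>" and pos: "\<And>v. norm v = 1 \<Longrightarrow> \<exists>i<n. \<eta> < v \<bullet> g i"
  shows "\<exists>!t. el_solution n g t"
proof -
  have "\<exists>i<n. 0 < v \<bullet> g i" if "v \<noteq> 0" for v
  proof -
    have "norm ((1 / norm v) *\<^sub>R v) = 1" using that by simp
    from pos[OF this] obtain i where "i < n" "\<eta> < (1 / norm v) * (v \<bullet> g i)" by auto
    then have "i < n" "0 < (1 / norm v) * (v \<bullet> g i)" using eta by linarith+
    then show ?thesis using that by (auto simp: zero_less_divide_iff)
  qed
  then show ?thesis
    using el_solution_exists[OF assms] el_solution_unique by blast
qed

text \<open>The left-hand side is largest at \<open>s = t\<close>.\<close>
lemma el_solution_ln_le:
  assumes t: "el_solution n g t" and pos: "\<And>i. i < n \<Longrightarrow> 0 < 1 + s \<bullet> g i"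
  shows "(\<Sum>i<n. ln (1 + s \<bullet> g i)) \<le> norm t * (\<Sum>i<n. norm (g i))"
proof -
  have "(\<Sum>i<n. ln (1 + s \<bullet> g i)) - (\<Sum>i<n. ln (1 + t \<bullet> g i))
        = (\<Sum>i<n. ln ((1 + s \<bullet> g i) / (1 + t \<bullet> g i)))"
    unfolding sum_subtractf[symmetric]
    using pos el_solution_pos[OF t] by (intro sum.cong refl ln_divide_pos[symmetric]) auto
  also have "\<dots> \<le> (\<Sum>i<n. ((s - t) \<bullet> g i) / (1 + t \<bullet> g i))"
  proof (intro sum_mono)
    fix i assume "i \<in> {..<n}"
    then have *: "0 < 1 + s \<bullet> g i" "0 < 1 + t \<bullet> g i" using pos el_solution_pos[OF t] by auto
    then have "ln ((1 + s \<bullet> g i) / (1 + t \<bullet> g i)) \<le> (1 + s \<bullet> g i) / (1 + t \<bullet> g i) - 1"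
      by (intro ln_le_minus_one) simp
    also have "\<dots> = ((s - t) \<bullet> g i) / (1 + t \<bullet> g i)"
      using * by (simp add: divide_simps inner_diff_left)
    finally show "ln ((1 + s \<bullet> g i) / (1 + t \<bullet> g i)) \<le> ((s - t) \<bullet> g i) / (1 + t \<bullet> g i)" .
  qed
  also have "\<dots> = 0" by (rule el_solution_sum_inner[OF t])
  finally have "(\<Sum>i<n. ln (1 + s \<bullet> g i)) \<le> (\<Sum>i<n. ln (1 + t \<bullet> g i))" by simp
  also have "\<dots> \<le> (\<Sum>i<n. norm t * norm (g i))"
  proof (intro sum_mono)
    fix i assume "i \<in> {..<n}"
    then have "ln (1 + t \<bullet> g i) \<le> t \<bullet> g i"
      using el_solution_pos[OF t] ln_le_minus_one[of "1 + t \<bullet> g i"] by auto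
    also have "\<dots> \<le> norm t * norm (g i)" by (rule norm_cauchy_schwarz)
    finally show "ln (1 + t \<bullet> g i) \<le> norm t * norm (g i)" .
  qed
  finally show ?thesis by (simp add: sum_distrib_left)
qed

section \<open>Functions in \<open>Phi\<close>\<close>

lemma Phi_continuous_on: "\<phi> \<in> Phi \<Longrightarrow> continuous_on {0<..} \<phi>"
  by (auto simp: Phi_def intro!: continuous_at_imp_continuous_on differentiable_imp_continuous_within)

text \<open>\<open>deriv \<phi>\<close> vanishes at \<open>1\<close> with positive slope, hence
  changes sign there; the mean value theorem turns this into strict positivity of
  \<open>\<phi>\<close> on both sides.\<close>

lemma Phi_pos_near_1:
  assumes phi: "\<phi> \<in> Phi" and eps: "0 < \<epsilon>"
  obtains h where "0 < h" "h < \<epsilon>" "h < 1" "0 < \<phi> (1 + h)" "0 < \<phi> (1 - h)"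
proof -
  have D: "(\<phi> has_real_derivative deriv \<phi> x) (at x)" if "0 < x" for x
    using phi that by (auto simp: Phi_def DERIV_deriv_iff_real_differentiable)
  have D2: "(deriv \<phi> has_real_derivative deriv (deriv \<phi>) 1) (at 1)"
    using phi by (auto simp: Phi_def DERIV_deriv_iff_real_differentiable)
  have one: "\<phi> 1 = 0" "deriv \<phi> 1 = 0" "deriv (deriv \<phi>) 1 > 0" using phi by (auto simp: Phi_def)
  from DERIV_pos_inc_right[OF D2 one(3)] obtain d1 where d1: "0 < d1"
    "\<And>h. 0 < h \<Longrightarrow> h < d1 \<Longrightarrow> 0 < deriv \<phi> (1 + h)" using one(2) by auto
  from DERIV_pos_inc_left[OF D2 one(3)] obtain d2 where d2: "0 < d2"
    "\<And>h. 0 < h \<Longrightarrow> h < d2 \<Longrightarrow> deriv \<phi> (1 - h) < 0" using one(2) by auto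
  \<comment> \<open>Halving makes the inequalities with all four bounds strict.\<close>
  define h where "h = min (min d1 d2) (min \<epsilon> 1) / 2"
  have h: "0 < h" "h < d1" "h < d2" "h < \<epsilon>" "h < 1"
    using d1(1) d2(1) eps by (auto simp: h_def min_def)
  obtain z where z: "1 < z" "z < 1 + h" "\<phi> (1 + h) - \<phi> 1 = (1 + h - 1) * deriv \<phi> z"
    using MVT2[of 1 "1 + h" \<phi> "deriv \<phi>"] D h by auto
  obtain y where y: "1 - h < y" "y < 1" "\<phi> 1 - \<phi> (1 - h) = (1 - (1 - h)) * deriv \<phi> y"
    using MVT2[of "1 - h" 1 \<phi> "deriv \<phi>"] D h by auto
  have "0 < deriv \<phi> z" using d1(2)[of "z - 1"] z h by simp
  then have "0 < \<phi> (1 + h)" using z(3) one h by simp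
  moreover have "deriv \<phi> y < 0" using d2(2)[of "1 - y"] y h by simp
  then have "0 < \<phi> (1 - h)" using y(3) one h mult_pos_neg[of h "deriv \<phi> y"] by simp
  ultimately show ?thesis using that h by blast
qed

text \<open>Convexity and \<open>\<phi> 1 = 0\<close> force growth at least linear in
  \<open>\<bar>u - 1\<bar>\<close> beyond distance \<open>h\<close>. Since
  \<open>u \<le> 1 + \<bar>u - 1\<bar>\<close>, the bound survives division by \<open>u\<close>,
  uniformly up to infinity.\<close>

lemma Phi_ratio_lower_bound:
  assumes phi: "\<phi> \<in> Phi" and eps: "0 < \<epsilon>"
  obtains c where "0 < c" "\<And>u. 0 < u \<Longrightarrow> \<epsilon> \<le> \<bar>u - 1\<bar> \<Longrightarrow> c \<le> \<phi> u / u"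
proof -
  obtain h where h: "0 < h" "h < \<epsilon>" "h < 1" "0 < \<phi> (1 + h)" "0 < \<phi> (1 - h)"
    using Phi_pos_near_1[OF assms] .
  have conv: "convex_on {0<..} \<phi>" and one: "\<phi> 1 = 0" using phi by (auto simp: Phi_def)
  define a where "a = min (\<phi> (1 + h)) (\<phi> (1 - h))"
  have a: "0 < a" using h by (simp add: a_def)
  have bound: "a / h * (\<epsilon> / (1 + \<epsilon>)) \<le> \<phi> u / u" if u: "0 < u" "\<epsilon> \<le> \<bar>u - 1\<bar>" for u
  proof -
    define r where "r = \<bar>u - 1\<bar>"
    have r: "h < r" "\<epsilon> \<le> r" "0 < r" "u \<le> 1 + r" using u h by (auto simp: r_def)
    have "a \<le> \<phi> (1 + sgn (u - 1) * h)"
      using r by (auto simp: a_def sgn_if r_def)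
    \<comment> \<open>The point at distance \<open>h\<close> from \<open>1\<close> on the side of
      \<open>u\<close> lies on the segment from \<open>1\<close> to \<open>u\<close>.\<close>
    also have "1 + sgn (u - 1) * h = (1 - h / r) *\<^sub>R 1 + (h / r) *\<^sub>R u"
    proof -
      have "u - 1 = sgn (u - 1) * r" by (simp add: r_def sgn_mult_abs)
      then have "(h / r) * (u - 1) = sgn (u - 1) * h"
        using r by (metis (no_types, opaque_lifting) less_irrefl mult.commute mult.left_commute
            nonzero_mult_div_cancel_left times_divide_eq_left)
      then show ?thesis by (simp add: algebra_simps diff_divide_distrib)
    qed
    also have "\<phi> \<dots> \<le> (1 - h / r) * \<phi> 1 + (h / r) * \<phi> u"
      using r h u by (intro convex_onD[OF conv]) auto
    finally have "a / h * r \<le> \<phi> u"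
      using one r h by (simp add: field_simps)
    \<comment> \<open>\<open>r / (1 + r)\<close> increases with \<open>r\<close>, so its value at
      \<open>\<epsilon>\<close> serves for all admissible \<open>u\<close>.\<close>
    have "a / h * (\<epsilon> / (1 + \<epsilon>)) \<le> a / h * (r / (1 + r))"
      using a h eps r by (intro mult_left_mono) (auto simp: field_simps)
    also have "\<dots> \<le> a / h * (r / u)"
      using a h u r by (intro mult_left_mono divide_left_mono) auto
    also have "\<dots> \<le> \<phi> u / u"
      using divide_right_mono[OF \<open>a / h * r \<le> \<phi> u\<close>, of u] u by simp
    finally show ?thesis .
  qed
  show ?thesis
    using a h eps by (intro that[of "a / h * (\<epsilon> / (1 + \<epsilon>))"] bound) auto
qed

lemma Phi_nonneg:
  assumes phi: "\<phi> \<in> Phi" and u: "0 < u"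
  shows "0 \<le> \<phi> u"
proof (cases "u = 1")
  case True then show ?thesis using phi by (simp add: Phi_def)
next
  case False
  then have "0 < \<bar>u - 1\<bar>" by simp
  from Phi_ratio_lower_bound[OF phi this] obtain c where "0 < c" "c \<le> \<phi> u / u"
    using u by blast
  then have "0 < \<phi> u / u" by simp
  then show ?thesis using u by (simp add: zero_less_divide_iff)
qed

section \<open>Deterministic lower bound for the statistic\<close>

text \<open>All randomness is packed into \<open>count\<close>, \<open>pos\<close>,
  \<open>lik\<close> and \<open>mean\<close>. The likelihood bound keeps the multiplier away from
  \<open>0\<close>; the set of \<open>\<A>\<close> belonging to its direction then supplies a
  fraction \<open>p\<close> of the observations, each contributing at least
  \<open>c\<close>.\<close>

lemma phi_stat_lower_bound:
  fixes g :: "nat \<Rightarrow> real ^ 'q"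
  assumes phi: "\<phi> \<in> Phi" and eta: "0 < \<eta>" and n: "0 < n" and p: "0 < p"
    and cover: "\<And>v. norm v = 1 \<Longrightarrow> \<exists>A\<in>\<A>. \<forall>x\<in>A. \<eta> < v \<bullet> x"
    and count: "\<And>A. A \<in> \<A> \<Longrightarrow> real n * p \<le> (\<Sum>i<n. indicator A (g i))"
    and pos: "\<And>i. i < n \<Longrightarrow> 0 < 1 + \<tau> \<bullet> g i"
    and lik: "real n * l \<le> (\<Sum>i<n. ln (1 + \<tau> \<bullet> g i))" "0 < l"
    and mean: "(\<Sum>i<n. norm (g i)) \<le> real n * m" "0 < m"
    and c: "\<And>u. 0 < u \<Longrightarrow> \<eta> * (l / m) \<le> \<bar>u - 1\<bar> \<Longrightarrow> c \<le> \<phi> u / u" "0 < c"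
  shows "2 / deriv (deriv \<phi>) 1 * (real n * (p * c)) \<le> phi_stat \<phi> n g"
proof -
  \<comment> \<open>Once every set of \<open>\<A>\<close> is hit, each unit direction has margin
    \<open>\<eta>\<close> in the sample, as existence of the multiplier requires.\<close>
  have hit: "\<exists>i<n. g i \<in> A" if "A \<in> \<A>" for A
  proof (rule ccontr)
    assume "\<not> (\<exists>i<n. g i \<in> A)"
    then have "(\<Sum>i<n. indicator A (g i)) = (0::real)" by (auto intro!: sum.neutral)
    moreover have "0 < real n * p" using n p by simp
    ultimately show False using count[OF that] by linarith
  qed
  have "\<exists>i<n. \<eta> < v \<bullet> g i" if "norm v = 1" for v
    using cover[OF that] hit by blast
  then have ex1: "\<exists>!t. el_solution n g t" by (rule el_solution_ex1[OF eta])
  define T where "T = el_multiplier n g"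
  have T: "el_solution n g T" unfolding T_def el_multiplier_def by (rule theI'[OF ex1])
  have upos: "0 < 1 + T \<bullet> g i" if "i < n" for i by (rule el_solution_pos[OF T that])
  \<comment> \<open>Comparing the likelihood at \<open>T\<close> with that at \<open>\<tau>\<close>
    bounds the length of \<open>T\<close> from below.\<close>
  have "real n * l \<le> norm T * (real n * m)"
    using lik el_solution_ln_le[OF T pos] mult_left_mono[OF mean(1) norm_ge_zero[of T]] by linarith
  then have T_ge: "l / m \<le> norm T" using n mean(2) by (simp add: field_simps)
  then have "0 < norm T" using lik(2) mean(2) by (meson divide_pos_pos less_le_trans)
  then have "norm ((1 / norm T) *\<^sub>R T) = 1" by simp
  from cover[OF this] obtain A where A: "A \<in> \<A>" "\<And>x. x \<in> A \<Longrightarrow> \<eta> < ((1 / norm T) *\<^sub>R T) \<bullet> x"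
    by blast
  have summand: "c * indicator A (g i) \<le> 1 / (1 + T \<bullet> g i) * \<phi> (1 + T \<bullet> g i)" if "i < n" for i
  proof (cases "g i \<in> A")
    case True
    have "\<eta> * norm T < T \<bullet> g i"
      using A(2)[OF True] \<open>0 < norm T\<close> by (simp add: field_simps)
    moreover have "\<eta> * (l / m) \<le> \<eta> * norm T" using T_ge eta by (intro mult_left_mono) auto
    ultimately have "\<eta> * (l / m) \<le> \<bar>(1 + T \<bullet> g i) - 1\<bar>" by linarith
    from c(1)[OF upos[OF that] this] True show ?thesis by simp
  next
    case False
    then show ?thesis using Phi_nonneg[OF phi] upos[OF that] by simp
  qed
  have "real n * (p * c) \<le> c * (\<Sum>i<n. indicator A (g i))"
    using mult_left_mono[OF count[OF A(1)], of c] c(2) by (simp add: ac_simps)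
  also have "\<dots> \<le> (\<Sum>i<n. 1 / (1 + T \<bullet> g i) * \<phi> (1 + T \<bullet> g i))"
    unfolding sum_distrib_left using summand by (intro sum_mono) simp
  finally have "2 / deriv (deriv \<phi>) 1 * (real n * (p * c)) \<le>
      2 / deriv (deriv \<phi>) 1 * (\<Sum>i<n. 1 / (1 + T \<bullet> g i) * \<phi> (1 + T \<bullet> g i))"
    using phi by (intro mult_left_mono) (auto simp: Phi_def)
  then show ?thesis using ex1 unfolding phi_stat_def T_def by simp
qed

section \<open>Measurability of the test statistic\<close>

text \<open>Compactness yields a convergent subsequence of the witnesses, whose limit is a witness
  for the limit point.\<close>

lemma closed_fst_compact:
  fixes R :: "('a :: first_countable_topology \<times> 'b :: metric_space) set"
  assumes "closed R" "compact K"
  shows "closed {x. \<exists>y\<in>K. (x, y) \<in> R}"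
  unfolding closed_sequential_limits
proof (intro allI impI, elim conjE)
  fix x l assume x: "\<forall>n. x n \<in> {x. \<exists>y\<in>K. (x, y) \<in> R}" and l: "x \<longlonglongrightarrow> l"
  then have "\<forall>n. \<exists>y. y \<in> K \<and> (x n, y) \<in> R" by blast
  then obtain y where y: "\<And>n. y n \<in> K" "\<And>n. (x n, y n) \<in> R"
    by (auto dest!: choice)
  then obtain z r where z: "z \<in> K" "strict_mono r" "(y \<circ> r) \<longlonglongrightarrow> z"
    using assms(2) unfolding compact_eq_seq_compact_metric by (elim seq_compactE) auto
  have "(\<lambda>n. (x (r n), y (r n))) \<longlonglongrightarrow> (l, z)"
    using LIMSEQ_subseq_LIMSEQ[OF l z(2)] z(3) by (intro tendsto_Pair) (auto simp: o_def)
  then have "(l, z) \<in> R"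
    by (rule closed_sequentially[OF assms(1), rotated]) (use y in auto)
  then show "l \<in> {x. \<exists>y\<in>K. (x, y) \<in> R}" using z by blast
qed

text \<open>Exhausting the second factor by compact balls reduces the projection to the compact
  case.\<close>

lemma borel_fst_closed:
  fixes R :: "('a :: first_countable_topology \<times> 'b :: euclidean_space) set"
  assumes "closed R"
  shows "{x. \<exists>y. (x, y) \<in> R} \<in> sets borel"
proof -
  have "{x. \<exists>y. (x, y) \<in> R} = (\<Union>k. {x. \<exists>y\<in>cball 0 (real k). (x, y) \<in> R})"
  proof (intro equalityI subsetI)
    fix x assume "x \<in> {x. \<exists>y. (x, y) \<in> R}"
    then obtain y where y: "(x, y) \<in> R" by blast
    obtain k :: nat where "norm y \<le> real k" using real_arch_simple by blast
    then have "y \<in> cball 0 (real k)" by simp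
    with y show "x \<in> (\<Union>k. {x. \<exists>y\<in>cball 0 (real k). (x, y) \<in> R})" by blast
  qed blast
  also have "\<dots> \<in> sets borel"
    by (intro sets.countable_UN) (auto intro!: borel_closed closed_fst_compact assms)
  finally show ?thesis .
qed

lemma continuous_on_fst_apply[continuous_intros]:
  "continuous_on A (\<lambda>p :: ('i \<Rightarrow> 'b::topological_space) \<times> 'c::topological_space. fst p i)"
  by (rule continuous_on_product_then_coordinatewise) (intro continuous_intros)

text \<open>The bound \<open>1 / n\<close> keeps the denominators away from zero, so the equation is
  a closed condition on the closed set \<open>?S\<close>.\<close>

lemma closed_el_solution:
  "closed {p :: (nat \<Rightarrow> real ^ 'q) \<times> (real ^ 'q). el_solution n (fst p) (snd p)}" (is "closed ?R")
proof -
  let ?S = "{p :: (nat \<Rightarrow> real ^ 'q) \<times> (real ^ 'q). \<forall>i<n. 1 / real n \<le> 1 + snd p \<bullet> fst p i}"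
  let ?F = "\<lambda>p :: (nat \<Rightarrow> real ^ 'q) \<times> (real ^ 'q).
              (1 / real n) *\<^sub>R (\<Sum>i<n. (1 / (1 + snd p \<bullet> fst p i)) *\<^sub>R fst p i)"
  have "closed ?S"
    by (intro closed_Collect_all closed_Collect_imp closed_Collect_le continuous_intros
        open_Collect_const)
  moreover have "continuous_on ?S ?F"
    by (intro continuous_intros) (use less_le_trans[of 0 "1 / real n"] in fastforce)
  ultimately have "closed (?S \<inter> ?F -` {0})"
    by (intro continuous_closed_preimage) auto
  also have "?S \<inter> ?F -` {0} = ?R" by (auto simp: el_solution_def)
  finally show ?thesis .
qed

text \<open>Without this the theorem would fail, because \<open>measure\<close> is \<open>0\<close> on nonmeasurable sets. The
  samples at which the statistic exceeds \<open>c\<close> are built from projections of closed sets along the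
  finite-dimensional space of multipliers, which are countable unions of closed sets.\<close>
lemma borel_phi_stat_gt:
  assumes cont: "continuous_on {0<..} \<phi>"
  shows "{g :: nat \<Rightarrow> real ^ 'q. c < phi_stat \<phi> n g} \<in> sets borel"
proof -
  define R where "R = {p :: (nat \<Rightarrow> real ^ 'q) \<times> (real ^ 'q). el_solution n (fst p) (snd p)}"
  define H where "H p = 2 / deriv (deriv \<phi>) 1 *
           (\<Sum>i<n. 1 / (1 + snd p \<bullet> fst p i) * \<phi> (1 + snd p \<bullet> fst p i))"
    for p :: "(nat \<Rightarrow> real ^ 'q) \<times> (real ^ 'q)"
  have "closed R" unfolding R_def by (rule closed_el_solution)
  have pos: "0 < 1 + snd p \<bullet> fst p i" if "p \<in> R" "i < n" for p i
    using that less_le_trans[of 0 "1 / real n"] by (fastforce simp: R_def el_solution_def)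
  have "continuous_on R (\<lambda>p. \<phi> (1 + snd p \<bullet> fst p i))" if "i < n" for i
    by (rule continuous_on_compose2[OF cont]) (use pos that in \<open>auto intro!: continuous_intros\<close>)
  then have H: "continuous_on R H"
    unfolding H_def using pos by (intro continuous_intros) fastforce+
  \<comment> \<open>Three projections decide the event: on \<open>E1 - E2\<close> the multiplier is
    unique and \<open>E3\<close> decides; elsewhere the default value \<open>0\<close> leaves the
    condition \<open>c < 0\<close>.\<close>
  define E1 where "E1 = {g. \<exists>t. (g, t) \<in> R}"
  define E2 where "E2 = {g. \<exists>t s. (g, t) \<in> R \<and> (g, s) \<in> R \<and> t \<noteq> s}"
  define E3 where "E3 = {g. \<exists>t. (g, t) \<in> R \<and> c < H (g, t)}"
  have E1: "E1 \<in> sets borel"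
    unfolding E1_def by (rule borel_fst_closed) fact
  \<comment> \<open>Distinctness is an open condition; closed sets with separation at least
    \<open>1 / (k + 1)\<close> exhaust it.\<close>
  let ?Q = "\<lambda>k. {p :: (nat \<Rightarrow> real ^ 'q) \<times> (real ^ 'q) \<times> (real ^ 'q).
                1 / real (Suc k) \<le> dist (fst (snd p)) (snd (snd p))}
           \<inter> (\<lambda>p. (fst p, fst (snd p))) -` R \<inter> (\<lambda>p. (fst p, snd (snd p))) -` R"
  have "closed (?Q k)" for k
    by (intro closed_Int closed_Collect_le closed_vimage \<open>closed R\<close> continuous_intros)
  then have "(\<Union>k. {g. \<exists>y. (g, y) \<in> ?Q k}) \<in> sets borel"
    by (intro sets.countable_UN image_subsetI borel_fst_closed)
  also have "(\<Union>k. {g. \<exists>y. (g, y) \<in> ?Q k}) = E2"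
  proof (intro equalityI subsetI)
    fix g assume "g \<in> E2"
    then obtain t s where ts: "(g, t) \<in> R" "(g, s) \<in> R" "0 < dist t s"
      by (auto simp: E2_def)
    then obtain k where "1 / real (Suc k) \<le> dist t s"
      using nat_approx_posE less_imp_le by metis
    then have "(g, (t, s)) \<in> ?Q k" using ts by simp
    then show "g \<in> (\<Union>k. {g. \<exists>y. (g, y) \<in> ?Q k})" by blast
  next
    fix g assume "g \<in> (\<Union>k. {g. \<exists>y. (g, y) \<in> ?Q k})"
    then obtain k t s where "(g, t) \<in> R" "(g, s) \<in> R" "1 / real (Suc k) \<le> dist t s"
      by auto
    moreover from this(3) have "t \<noteq> s" by auto
    ultimately show "g \<in> E2" unfolding E2_def by blast
  qed
  finally have E2: "E2 \<in> sets borel" .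
  \<comment> \<open>The strict inequality is exhausted by closed conditions in the same way.\<close>
  let ?P = "\<lambda>k. R \<inter> H -` {c + 1 / real (Suc k)..}"
  have "closed (?P k)" for k
    by (intro continuous_closed_preimage H \<open>closed R\<close>) simp
  then have "(\<Union>k. {g. \<exists>t. (g, t) \<in> ?P k}) \<in> sets borel"
    by (intro sets.countable_UN image_subsetI borel_fst_closed)
  also have "(\<Union>k. {g. \<exists>t. (g, t) \<in> ?P k}) = E3"
  proof (intro equalityI subsetI)
    fix g assume "g \<in> E3"
    then obtain t where t: "(g, t) \<in> R" "0 < H (g, t) - c" by (auto simp: E3_def)
    then obtain k where "1 / real (Suc k) \<le> H (g, t) - c"
      using nat_approx_posE less_imp_le by metis
    then have "(g, t) \<in> ?P k" using t by simp
    then show "g \<in> (\<Union>k. {g. \<exists>t. (g, t) \<in> ?P k})" by blast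
  next
    fix g assume "g \<in> (\<Union>k. {g. \<exists>t. (g, t) \<in> ?P k})"
    then obtain k t where t: "(g, t) \<in> R" "c + 1 / real (Suc k) \<le> H (g, t)" by auto
    have "0 < 1 / real (Suc k)" by simp
    then have "c < H (g, t)" using t(2) by linarith
    with t(1) show "g \<in> E3" unfolding E3_def by blast
  qed
  finally have E3: "E3 \<in> sets borel" .
  have ex1: "(\<exists>!t. el_solution n g t) \<longleftrightarrow> g \<in> E1 - E2" for g
    unfolding E1_def E2_def R_def by auto
  have "c < phi_stat \<phi> n g \<longleftrightarrow> (if g \<in> E1 - E2 then g \<in> E3 else c < 0)" for g
  proof (cases "\<exists>!t. el_solution n g t")
    case True
    then have sol: "el_solution n g t \<longleftrightarrow> t = el_multiplier n g" for t
      unfolding el_multiplier_def by (metis the_equality)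
    have "phi_stat \<phi> n g = H (g, el_multiplier n g)"
      unfolding phi_stat_def H_def using True by simp
    moreover have "g \<in> E3 \<longleftrightarrow> c < H (g, el_multiplier n g)"
      unfolding E3_def R_def by (simp add: sol)
    ultimately show ?thesis using True ex1 by simp
  next
    case False
    then show ?thesis using ex1[of g] by (simp add: phi_stat_def del: Diff_iff)
  qed
  then have "{g. c < phi_stat \<phi> n g} = ((E1 - E2) \<inter> E3) \<union> (if c < 0 then - (E1 - E2) else {})"
    by (auto split: if_splits)
  also have "\<dots> \<in> sets borel" using E1 E2 E3 by auto
  finally show ?thesis .
qed

section \<open>Weak law of large numbers\<close>

text \<open>The new variable is independent of the remaining sum, so the mixed term has expectation
  zero. Integrability and value go through one induction because the value needs both.\<close>

lemma (in prob_space) second_moment_indep_sum: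
  fixes Z :: "'i \<Rightarrow> 'a \<Rightarrow> real"
  assumes fin: "finite I" and indep: "indep_vars (\<lambda>_. borel) Z I"
    and sq: "\<And>i. i \<in> I \<Longrightarrow> integrable M (\<lambda>w. (Z i w)\<^sup>2)"
    and mean: "\<And>i. i \<in> I \<Longrightarrow> expectation (Z i) = 0"
  shows "integrable M (\<lambda>w. (\<Sum>i\<in>I. Z i w)\<^sup>2) \<and>
         expectation (\<lambda>w. (\<Sum>i\<in>I. Z i w)\<^sup>2) = (\<Sum>i\<in>I. expectation (\<lambda>w. (Z i w)\<^sup>2))"
  using assms
proof (induction I)
  case (insert j J)
  let ?S = "\<lambda>w. \<Sum>i\<in>J. Z i w"
  have meas: "\<And>i. i \<in> insert j J \<Longrightarrow> Z i \<in> borel_measurable M"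
    by (rule bspec[OF conjunct1[OF insert.prems(1)[unfolded indep_vars_def]]])
  have int: "\<And>i. i \<in> insert j J \<Longrightarrow> integrable M (Z i)"
    by (rule square_integrable_imp_integrable[OF meas insert.prems(2)])
  have IH: "integrable M (\<lambda>w. (?S w)\<^sup>2)"
      "expectation (\<lambda>w. (?S w)\<^sup>2) = (\<Sum>i\<in>J. expectation (\<lambda>w. (Z i w)\<^sup>2))"
    using insert.IH[OF indep_vars_subset[OF insert.prems(1)]] insert.prems(2,3) by blast+
  have ind: "indep_var borel (Z j) borel ?S"
    using insert.hyps insert.prems(1) by (intro indep_vars_sum) auto
  have S: "integrable M ?S" using int by (intro Bochner_Integration.integrable_sum) blast
  have cross: "integrable M (\<lambda>w. Z j w * ?S w)" "expectation (\<lambda>w. Z j w * ?S w) = 0"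
    using indep_var_integrable[OF ind int S] indep_var_lebesgue_integral[OF ind int S]
    by (simp_all add: insert.prems(3))
  have *: "(\<lambda>w. (\<Sum>i\<in>insert j J. Z i w)\<^sup>2) = (\<lambda>w. (Z j w)\<^sup>2 + 2 * (Z j w * ?S w) + (?S w)\<^sup>2)"
    using insert.hyps by (auto simp: power2_sum fun_eq_iff)
  have sq: "integrable M (\<lambda>w. (Z j w)\<^sup>2)" using insert.prems(2) by blast
  show ?case
    unfolding * using insert.hyps sq cross IH by simp
qed simp

text \<open>Chebyshev's inequality for the centred sum, whose second moment is \<open>n * v\<close>,
  gives a bound of order \<open>1 / n\<close>.\<close>

lemma (in prob_space) weak_law_L2:
  fixes Z :: "nat \<Rightarrow> 'a \<Rightarrow> real"
  assumes indep: "indep_vars (\<lambda>_. borel) Z UNIV"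
    and sq: "\<And>i. integrable M (\<lambda>w. (Z i w)\<^sup>2)"
    and mean: "\<And>i. expectation (Z i) = m"
    and var: "\<And>i. expectation (\<lambda>w. (Z i w - m)\<^sup>2) = v"
    and eps: "0 < \<epsilon>"
  shows "(\<lambda>n. prob {w \<in> space M. \<bar>(\<Sum>i<n. Z i w) - real n * m\<bar> \<ge> real n * \<epsilon>}) \<longlonglongrightarrow> 0"
proof -
  have meas[measurable]: "Z i \<in> borel_measurable M" for i
    using indep unfolding indep_vars_def by blast
  have int[simp]: "integrable M (Z i)" for i
    by (rule square_integrable_imp_integrable[OF meas sq])
  define W where "W i w = Z i w - m" for i w
  have indepW: "indep_vars (\<lambda>_. borel) W UNIV"
    unfolding W_def
    by (rule indep_vars_compose2[OF indep, where Y = "\<lambda>_ z. z - m"]) measurable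
  have sqW: "integrable M (\<lambda>w. (W i w)\<^sup>2)" for i
    unfolding W_def power2_diff
    by (intro Bochner_Integration.integrable_add Bochner_Integration.integrable_diff sq
        integrable_const integrable_mult_left integrable_mult_right int)
  have meanW: "expectation (W i) = 0" for i
    unfolding W_def using mean by (simp add: prob_space)
  have sec: "integrable M (\<lambda>w. (\<Sum>i<n. W i w)\<^sup>2)"
      "expectation (\<lambda>w. (\<Sum>i<n. W i w)\<^sup>2) = real n * v" for n
  proof -
    have "indep_vars (\<lambda>_. borel) W {..<n}" by (rule indep_vars_subset[OF indepW]) simp
    note * = second_moment_indep_sum[OF finite_lessThan this sqW meanW]
    have v: "expectation (\<lambda>w. (W i w)\<^sup>2) = v" for i unfolding W_def by (rule var)
    show "integrable M (\<lambda>w. (\<Sum>i<n. W i w)\<^sup>2)" using * by blast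
    show "expectation (\<lambda>w. (\<Sum>i<n. W i w)\<^sup>2) = real n * v"
      using * unfolding v by simp
  qed
  \<comment> \<open>At \<open>n = 0\<close> the event is the whole space, so only positive
    \<open>n\<close> is claimed.\<close>
  have bound: "prob {w \<in> space M. \<bar>(\<Sum>i<n. Z i w) - real n * m\<bar> \<ge> real n * \<epsilon>}
               \<le> (v / \<epsilon>\<^sup>2) * (1 / real n)" if "0 < n" for n
  proof -
    have "expectation (\<lambda>w. \<Sum>i<n. W i w) = 0"
    proof (subst Bochner_Integration.integral_sum)
      show "integrable M (W i)" for i unfolding W_def by simp
    qed (simp add: meanW)
    moreover have "(\<lambda>w. \<Sum>i<n. W i w) \<in> borel_measurable M"
      unfolding W_def by measurable
    ultimately have "prob {w \<in> space M. \<bar>\<Sum>i<n. W i w\<bar> \<ge> real n * \<epsilon>} \<le> (real n * v) / (real n * \<epsilon>)\<^sup>2"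
      using Chebyshev_inequality[of "\<lambda>w. \<Sum>i<n. W i w" "real n * \<epsilon>"] sec that eps
      by simp
    also have "(real n * v) / (real n * \<epsilon>)\<^sup>2 = (v / \<epsilon>\<^sup>2) * (1 / real n)"
      using that eps by (simp add: field_simps power2_eq_square)
    finally show ?thesis unfolding W_def by (simp only: sum_subtractf sum_constant card_lessThan)
  qed
  have lim: "(\<lambda>n. (v / \<epsilon>\<^sup>2) * (1 / real n)) \<longlonglongrightarrow> 0"
    by (rule tendsto_mult_right_zero[OF lim_1_over_n])
  show ?thesis
  proof (rule tendsto_sandwich[OF _ _ tendsto_const lim])
    show "\<forall>\<^sub>F n in sequentially. prob {w \<in> space M. \<bar>(\<Sum>i<n. Z i w) - real n * m\<bar> \<ge> real n * \<epsilon>}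
            \<le> (v / \<epsilon>\<^sup>2) * (1 / real n)"
      using eventually_gt_at_top[of 0] by eventually_elim (rule bound)
  qed simp
qed

text \<open>Moments depend on the law alone, so those of \<open>f (Gs i w)\<close> can be computed
  from \<open>G\<close>.\<close>

lemma (in prob_space) weak_law_identically_distributed:
  fixes Gs :: "nat \<Rightarrow> 'a \<Rightarrow> 'b :: topological_space" and f :: "'b \<Rightarrow> real"
  assumes indep: "indep_vars (\<lambda>_. borel) Gs UNIV"
    and G[measurable]: "G \<in> borel_measurable M"
    and copies: "\<And>i. distr M borel (Gs i) = distr M borel G"
    and f[measurable]: "f \<in> borel_measurable borel"
    and sq: "integrable M (\<lambda>w. (f (G w))\<^sup>2)"
    and eps: "0 < \<epsilon>"
  shows "(\<lambda>n. prob {w \<in> space M. \<bar>(\<Sum>i<n. f (Gs i w)) - real n * expectation (\<lambda>w. f (G w))\<bar>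
                      \<ge> real n * \<epsilon>}) \<longlonglongrightarrow> 0"
proof -
  have Gs[measurable]: "Gs i \<in> borel_measurable M" for i
    using indep unfolding indep_vars_def by blast
  have transfer: "integral\<^sup>L M (\<lambda>w. h (Gs i w)) = integral\<^sup>L M (\<lambda>w. h (G w))"
    if [measurable]: "h \<in> borel_measurable borel" for h :: "'b \<Rightarrow> real" and i
  proof -
    have "integral\<^sup>L M (\<lambda>w. h (Gs i w)) = integral\<^sup>L (distr M borel (Gs i)) h"
      by (rule integral_distr[symmetric]) measurable
    also have "\<dots> = integral\<^sup>L M (\<lambda>w. h (G w))"
      unfolding copies by (rule integral_distr) measurable
    finally show ?thesis .
  qed
  have "integrable M (\<lambda>w. (f (Gs i w))\<^sup>2)" for i
  proof -
    have "integrable (distr M borel (Gs i)) (\<lambda>x. (f x)\<^sup>2)"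
      unfolding copies by (subst integrable_distr_eq) (use sq in measurable)
    then show ?thesis by (subst (asm) integrable_distr_eq) measurable
  qed
  moreover have "indep_vars (\<lambda>_. borel) (\<lambda>i w. f (Gs i w)) UNIV"
    by (rule indep_vars_compose2[OF indep, where Y = "\<lambda>_. f"]) measurable
  moreover have "(\<lambda>x. (f x - expectation (\<lambda>w. f (G w)))\<^sup>2) \<in> borel_measurable borel"
    by measurable
  note transfer[OF this]
  ultimately show ?thesis
    using transfer[OF f]
    by (intro weak_law_L2[OF _ _ _ _ eps,
          where v = "expectation (\<lambda>w. (f (G w) - expectation (\<lambda>w. f (G w)))\<^sup>2)"]) auto
qed

section \<open>Divergence of the test statistic under the alternative\<close>

text \<open>Union bound: up to a null set, finitely many bad events of vanishing probability cover
  the complement of \<open>E n\<close>.\<close>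

lemma (in prob_space) tendsto_prob_1I:
  assumes fin: "finite J" and B: "\<And>j n. j \<in> J \<Longrightarrow> B j n \<in> events" and E: "\<And>n. E n \<in> events"
    and lim: "\<And>j. j \<in> J \<Longrightarrow> (\<lambda>n. prob (B j n)) \<longlonglongrightarrow> 0"
    and cover: "\<forall>\<^sub>F n in sequentially. AE w in M. (\<forall>j\<in>J. w \<notin> B j n) \<longrightarrow> w \<in> E n"
  shows "(\<lambda>n. prob (E n)) \<longlonglongrightarrow> 1"
proof (rule tendsto_sandwich[where h = "\<lambda>_. 1"])
  have "(\<lambda>n. 1 - (\<Sum>j\<in>J. prob (B j n))) \<longlonglongrightarrow> 1 - (\<Sum>j\<in>J. 0)"
    by (intro tendsto_intros lim)
  then show "(\<lambda>n. 1 - (\<Sum>j\<in>J. prob (B j n))) \<longlonglongrightarrow> 1" by simp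
  show "\<forall>\<^sub>F n in sequentially. 1 - (\<Sum>j\<in>J. prob (B j n)) \<le> prob (E n)"
    using cover
  proof eventually_elim
    case (elim n)
    have U: "(\<Union>j\<in>J. B j n) \<in> events" using fin B by (intro sets.finite_UN) auto
    have "1 = prob (space M)" by (simp add: prob_space)
    also have "\<dots> \<le> prob ((\<Union>j\<in>J. B j n) \<union> E n)"
      using elim U E by (intro finite_measure_mono_AE) auto
    also have "\<dots> \<le> prob (\<Union>j\<in>J. B j n) + prob (E n)"
      using U E by (rule measure_Un_le)
    also have "prob (\<Union>j\<in>J. B j n) \<le> (\<Sum>j\<in>J. prob (B j n))"
      using fin B by (intro finite_measure_subadditive_finite) auto
    finally show ?case by simp
  qed
qed (auto intro: always_eventually)

text \<open>For each direction, countably many bounded sets with positive margin exhaust the open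
  half-space, so one has positive probability. Boundedness lets the margin survive small changes of
  direction, and compactness of the sphere leaves finitely many sets.\<close>

lemma (in prob_space) finite_direction_cover:
  fixes G :: "'a \<Rightarrow> 'b :: euclidean_space"
  assumes G[measurable]: "G \<in> borel_measurable M"
    and nondeg: "\<And>v. v \<noteq> 0 \<Longrightarrow> \<not> (AE w in M. v \<bullet> G w \<le> 0)"
  obtains \<A> \<eta> where "finite \<A>" "0 < \<eta>"
    "\<And>A. A \<in> \<A> \<Longrightarrow> A \<in> sets borel \<and> 0 < prob {w \<in> space M. G w \<in> A}"
    "\<And>v. norm v = 1 \<Longrightarrow> \<exists>A\<in>\<A>. \<forall>x\<in>A. \<eta> < v \<bullet> x"
proof -
  \<comment> \<open>With norm at most \<open>k + 1\<close>, moving \<open>v\<close> by less than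
    \<open>1 / (k + 1)^2\<close> costs at most half of the margin
    \<open>2 / (k + 1)\<close>.\<close>
  define A where "A v k = {x :: 'b. 2 / real (Suc k) < v \<bullet> x \<and> norm x \<le> real (Suc k)}" for v k
  have A_borel[measurable]: "A v k \<in> sets borel" for v k
    unfolding A_def by measurable
  have "\<exists>k. 0 < prob {w \<in> space M. G w \<in> A v k}" if "v \<noteq> 0" for v
  proof (rule ccontr)
    assume "\<nexists>k. 0 < prob {w \<in> space M. G w \<in> A v k}"
    then have zero: "prob {w \<in> space M. G w \<in> A v k} = 0" for k
      by (simp add: zero_less_measure_iff)
    have "AE w in M. G w \<notin> A v k" for k
      using zero[of k] by (subst (asm) prob_eq_0) auto
    then have "AE w in M. \<forall>k. G w \<notin> A v k" by (simp add: AE_all_countable)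
    then have "AE w in M. v \<bullet> G w \<le> 0"
    proof eventually_elim
      case (elim w)
      show ?case
      proof (rule ccontr)
        assume "\<not> v \<bullet> G w \<le> 0"
        then have pos: "0 < v \<bullet> G w" by simp
        obtain k :: nat where k: "max (norm (G w)) (2 / (v \<bullet> G w)) < real k"
          using reals_Archimedean2 by blast
        then have "2 / (v \<bullet> G w) < real (Suc k)" "norm (G w) \<le> real (Suc k)" by auto
        then have "G w \<in> A v k"
          unfolding A_def using pos by (simp add: field_simps)
        with elim show False by blast
      qed
    qed
    with nondeg[OF that] show False ..
  qed
  then obtain k where k: "\<And>v. v \<noteq> 0 \<Longrightarrow> 0 < prob {w \<in> space M. G w \<in> A v (k v)}"
    by metis
  let ?r = "\<lambda>v. 1 / (real (Suc (k v)))\<^sup>2"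
  have cover: "sphere (0::'b) 1 \<subseteq> (\<Union>v\<in>sphere 0 1. ball v (?r v))"
  proof
    fix v :: 'b assume "v \<in> sphere 0 1"
    moreover have "v \<in> ball v (?r v)" by simp
    ultimately show "v \<in> (\<Union>v\<in>sphere 0 1. ball v (?r v))" by (rule UN_I)
  qed
  obtain V where V: "V \<subseteq> sphere 0 1" "finite V" "sphere (0::'b) 1 \<subseteq> (\<Union>v\<in>V. ball v (?r v))"
    by (rule compactE_image[OF compact_sphere _ cover]) auto
  \<comment> \<open>The inserted \<open>1\<close> makes this a minimum over a nonempty set.\<close>
  define \<eta> where "\<eta> = Min (insert 1 ((\<lambda>v. 1 / real (Suc (k v))) ` V))"
  have eta: "0 < \<eta>" "\<And>v. v \<in> V \<Longrightarrow> \<eta> \<le> 1 / real (Suc (k v))"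
    unfolding \<eta>_def using V(2) by (auto simp: Min_gr_iff intro!: Min_le)
  show ?thesis
  proof (rule that[of "(\<lambda>v. A v (k v)) ` V" \<eta>])
    fix B assume "B \<in> (\<lambda>v. A v (k v)) ` V"
    then obtain v where v: "v \<in> V" "B = A v (k v)" by blast
    have "v \<noteq> 0" using V(1) v(1) by auto
    with k v show "B \<in> sets borel \<and> 0 < prob {w \<in> space M. G w \<in> B}" by simp
  next
    fix u :: 'b assume "norm u = 1"
    then have "u \<in> sphere 0 1" by simp
    then obtain v where v: "v \<in> V" "norm (v - u) < ?r v" using V(3) by (auto simp: dist_norm)
    have "\<eta> < u \<bullet> x" if x: "x \<in> A v (k v)" for x
    proof -
      have "(v - u) \<bullet> x \<le> norm (v - u) * norm x" by (rule norm_cauchy_schwarz)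
      also have "\<dots> \<le> ?r v * real (Suc (k v))"
        using v x by (intro mult_mono) (auto simp: A_def)
      also have "\<dots> = 1 / real (Suc (k v))" by (simp add: power2_eq_square)
      finally have "v \<bullet> x - 1 / real (Suc (k v)) \<le> u \<bullet> x" by (simp add: inner_diff_left)
      moreover have "2 / real (Suc (k v)) < v \<bullet> x" using x by (simp add: A_def)
      moreover have "2 / real (Suc (k v)) = 1 / real (Suc (k v)) + 1 / real (Suc (k v))" by simp
      ultimately show ?thesis using eta(2)[OF v(1)] by linarith
    qed
    then show "\<exists>B\<in>(\<lambda>v. A v (k v)) ` V. \<forall>x\<in>B. \<eta> < u \<bullet> x" using v(1) by blast
  qed (use V eta in auto)
qed

section \<open>Logarithmic inequalities and the population multiplier\<close>

text \<open>Everything comes from \<open>ln x \<le> x - 1\<close> and its equality case, at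
  \<open>1 + a\<close> and \<open>1 / (1 + a)\<close>. The first bound serves to make the
  log-likelihood square integrable.\<close>

lemma ln_one_plus_bounds:
  fixes a :: real
  assumes "0 < 1 + a"
  shows "(ln (1 + a))\<^sup>2 \<le> a\<^sup>2 + (a / (1 + a))\<^sup>2"
    and "a / (1 + a) \<le> ln (1 + a)"
    and "ln (1 + a) = a / (1 + a) \<Longrightarrow> a = 0"
proof -
  have "ln (1 / (1 + a)) \<le> 1 / (1 + a) - 1" using assms by (intro ln_le_minus_one) simp
  moreover have "1 / (1 + a) - 1 = - (a / (1 + a))" using assms by (simp add: field_simps)
  moreover have "ln (1 / (1 + a)) = - ln (1 + a)" using assms by (simp add: ln_divide_pos)
  ultimately show l: "a / (1 + a) \<le> ln (1 + a)" by simp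
  have u: "ln (1 + a) \<le> a" using ln_le_minus_one[OF assms] by simp
  show "(ln (1 + a))\<^sup>2 \<le> a\<^sup>2 + (a / (1 + a))\<^sup>2"
  proof (cases "0 \<le> ln (1 + a)")
    case True
    then have "(ln (1 + a))\<^sup>2 \<le> a\<^sup>2" using u by (intro power_mono)
    then show ?thesis by (simp add: add_increasing2)
  next
    case False
    then have "(- ln (1 + a))\<^sup>2 \<le> (- (a / (1 + a)))\<^sup>2" using l by (intro power_mono) auto
    then show ?thesis by (simp add: add_increasing)
  qed
  assume "ln (1 + a) = a / (1 + a)"
  then have "ln (1 / (1 + a)) = 1 / (1 + a) - 1"
    using \<open>1 / (1 + a) - 1 = - (a / (1 + a))\<close> \<open>ln (1 / (1 + a)) = - ln (1 + a)\<close> by simp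
  then have "1 / (1 + a) = 1" using assms by (intro ln_eq_minus_one) auto
  then show "a = 0" using assms by simp
qed

text \<open>Positivity comes from the equality case of \<open>ln (1 + a) \<ge> a / (1 + a)\<close>.\<close>
lemma (in prob_space) expected_log_likelihood_pos:
  fixes G :: "'a \<Rightarrow> 'b :: euclidean_space"
  assumes G[measurable]: "G \<in> borel_measurable M"
    and nondeg: "\<not> (AE w in M. \<tau> \<bullet> G w = 0)"
    and pos: "AE w in M. 0 < 1 + \<tau> \<bullet> G w"
    and int: "integrable M (\<lambda>w. (\<tau> \<bullet> G w) / (1 + \<tau> \<bullet> G w))"
    and zero: "expectation (\<lambda>w. (\<tau> \<bullet> G w) / (1 + \<tau> \<bullet> G w)) = 0"
    and int_ln: "integrable M (\<lambda>w. ln (1 + \<tau> \<bullet> G w))"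
  shows "0 < expectation (\<lambda>w. ln (1 + \<tau> \<bullet> G w))"
proof -
  let ?D = "\<lambda>w. ln (1 + \<tau> \<bullet> G w) - (\<tau> \<bullet> G w) / (1 + \<tau> \<bullet> G w)"
  have D: "AE w in M. 0 \<le> ?D w"
    using pos by eventually_elim (simp add: ln_one_plus_bounds(2))
  have int_D: "integrable M ?D" using int int_ln by simp
  have eq: "expectation ?D = expectation (\<lambda>w. ln (1 + \<tau> \<bullet> G w))"
    using int int_ln zero by simp
  have "expectation ?D \<noteq> 0"
  proof
    assume "expectation ?D = 0"
    then have "AE w in M. ?D w = 0"
      using integral_nonneg_eq_0_iff_AE[OF int_D D] by simp
    then have "AE w in M. \<tau> \<bullet> G w = 0"
      using pos by eventually_elim (simp add: ln_one_plus_bounds(3))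
    with nondeg show False ..
  qed
  then show ?thesis using integral_nonneg_AE[OF D] eq by simp
qed

text \<open>Otherwise the quotient would have constant sign and mean zero, hence vanish almost
  surely.\<close>

lemma (in prob_space) inner_pos_with_pos_prob:
  fixes G :: "'a \<Rightarrow> 'b :: euclidean_space"
  assumes nondeg: "\<not> (AE w in M. v \<bullet> G w = 0)"
    and pos: "AE w in M. 0 < 1 + \<tau> \<bullet> G w"
    and int: "integrable M (\<lambda>w. (v \<bullet> G w) / (1 + \<tau> \<bullet> G w))"
    and zero: "expectation (\<lambda>w. (v \<bullet> G w) / (1 + \<tau> \<bullet> G w)) = 0"
  shows "\<not> (AE w in M. v \<bullet> G w \<le> 0)"
proof
  assume le: "AE w in M. v \<bullet> G w \<le> 0"
  have "AE w in M. 0 \<le> - ((v \<bullet> G w) / (1 + \<tau> \<bullet> G w))"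
    using le pos by eventually_elim (simp add: divide_nonpos_pos)
  moreover have "integrable M (\<lambda>w. - ((v \<bullet> G w) / (1 + \<tau> \<bullet> G w)))"
    "expectation (\<lambda>w. - ((v \<bullet> G w) / (1 + \<tau> \<bullet> G w))) = 0"
    using int zero by simp_all
  ultimately have "AE w in M. - ((v \<bullet> G w) / (1 + \<tau> \<bullet> G w)) = 0"
    using integral_nonneg_eq_0_iff_AE by blast
  then have "AE w in M. v \<bullet> G w = 0"
    using pos by eventually_elim auto
  with nondeg show False ..
qed

text \<open>The weak law is applied to finitely many test functions: the log-likelihood, the norm
  and the indicators of the covering sets. When all sample means are near their expectations,
  \<open>phi_stat_lower_bound\<close> applies.\<close>

lemma (in prob_space) phi_stat_diverges:
  fixes G :: "'a \<Rightarrow> real ^ 'q"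
  assumes indep: "indep_vars (\<lambda>_. borel) Gs UNIV"
    and G[measurable]: "G \<in> borel_measurable M"
    and copies: "\<And>i. distr M borel (Gs i) = distr M borel G"
    and sq: "integrable M (\<lambda>w. (norm (G w))\<^sup>2)"
    and nondeg: "\<And>v. v \<noteq> 0 \<Longrightarrow> \<not> (AE w in M. v \<bullet> G w = 0)"
    and pos: "AE w in M. 0 < 1 + \<tau> \<bullet> G w"
    and sol: "pop_solution M G \<tau>" "\<tau> \<noteq> 0"
    and sq2: "integrable M (\<lambda>w. ((\<tau> \<bullet> G w) / (1 + \<tau> \<bullet> G w))\<^sup>2)"
    and phi: "\<phi> \<in> Phi"
  shows "(\<lambda>n. prob {w \<in> space M. c < phi_stat \<phi> n (\<lambda>i. Gs i w)}) \<longlonglongrightarrow> 1"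
proof -
  have Gs[measurable]: "Gs i \<in> borel_measurable M" for i
    using indep unfolding indep_vars_def by blast
  have stat: "integrable M (\<lambda>w. (v \<bullet> G w) / (1 + \<tau> \<bullet> G w))"
    "expectation (\<lambda>w. (v \<bullet> G w) / (1 + \<tau> \<bullet> G w)) = 0" for v
  proof -
    have *: "integrable M (\<lambda>w. (1 / (1 + \<tau> \<bullet> G w)) *\<^sub>R G w)"
      "expectation (\<lambda>w. (1 / (1 + \<tau> \<bullet> G w)) *\<^sub>R G w) = 0"
      using sol by (auto simp: pop_solution_def)
    show "integrable M (\<lambda>w. (v \<bullet> G w) / (1 + \<tau> \<bullet> G w))"
      using integrable_inner_right[OF *(1), of v] by simp
    show "expectation (\<lambda>w. (v \<bullet> G w) / (1 + \<tau> \<bullet> G w)) = 0"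
      using integral_inner_right[OF *(1), of v] *(2) by simp
  qed
  have both: "\<not> (AE w in M. v \<bullet> G w \<le> 0)" if "v \<noteq> 0" for v
    by (rule inner_pos_with_pos_prob[OF nondeg[OF that] pos stat])
  obtain \<A> \<eta> where A: "finite \<A>" "0 < \<eta>"
    "\<And>A. A \<in> \<A> \<Longrightarrow> A \<in> sets borel \<and> 0 < prob {w \<in> space M. G w \<in> A}"
    "\<And>v. norm v = 1 \<Longrightarrow> \<exists>A\<in>\<A>. \<forall>x\<in>A. \<eta> < v \<bullet> x"
    by (rule finite_direction_cover[OF G both]) (assumption, rule that)
  define ind :: "(real ^ 'q) set \<Rightarrow> real ^ 'q \<Rightarrow> real" where "ind A = indicator A" for A
  define lnf :: "real ^ 'q \<Rightarrow> real" where "lnf x = ln (1 + \<tau> \<bullet> x)" for x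
  \<comment> \<open>Adding \<open>1\<close> makes the mean positive at once, so that half of it can
    serve as a tolerance.\<close>
  define nrm :: "real ^ 'q \<Rightarrow> real" where "nrm x = 1 + norm x" for x
  define F where "F = insert lnf (insert nrm (ind ` \<A>))"
  define \<mu> where "\<mu> f = expectation (\<lambda>w. f (G w))" for f :: "real ^ 'q \<Rightarrow> real"
  have int_norm: "integrable M (\<lambda>w. norm (G w))"
    by (rule square_integrable_imp_integrable[OF _ sq]) measurable
  \<comment> \<open>The square of the logarithm is dominated by second moments that
    \<open>sq\<close> and \<open>sq2\<close> make finite.\<close>
  have sq_ln: "integrable M (\<lambda>w. (lnf (G w))\<^sup>2)"
  proof (rule Bochner_Integration.integrable_bound)
    show "integrable M (\<lambda>w. (norm \<tau>)\<^sup>2 * (norm (G w))\<^sup>2 + ((\<tau> \<bullet> G w) / (1 + \<tau> \<bullet> G w))\<^sup>2)"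
      using sq sq2 by simp
    show "AE w in M. norm ((lnf (G w))\<^sup>2)
        \<le> norm ((norm \<tau>)\<^sup>2 * (norm (G w))\<^sup>2 + ((\<tau> \<bullet> G w) / (1 + \<tau> \<bullet> G w))\<^sup>2)"
      using pos
    proof eventually_elim
      case (elim w)
      have "\<bar>\<tau> \<bullet> G w\<bar>\<^sup>2 \<le> (norm \<tau> * norm (G w))\<^sup>2"
        by (intro power_mono Cauchy_Schwarz_ineq2) simp
      then show ?case
        using ln_one_plus_bounds(1)[OF elim] by (simp add: lnf_def power_mult_distrib)
    qed
  qed (simp add: lnf_def)
  have F: "f \<in> borel_measurable borel" "integrable M (\<lambda>w. (f (G w))\<^sup>2)" "0 < \<mu> f"
    if "f \<in> F" for f
  proof -
    consider "f = lnf" | "f = nrm" | A where "A \<in> \<A>" "f = ind A"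
      using \<open>f \<in> F\<close> by (auto simp: F_def)
    then have "f \<in> borel_measurable borel \<and> integrable M (\<lambda>w. (f (G w))\<^sup>2) \<and> 0 < \<mu> f"
    proof cases
      case 1
      have m: "lnf \<in> borel_measurable borel" unfolding lnf_def by measurable
      have "integrable M (\<lambda>w. lnf (G w))"
        by (rule square_integrable_imp_integrable[OF measurable_compose[OF G m] sq_ln])
      then have "0 < \<mu> lnf"
        unfolding \<mu>_def lnf_def
        by (intro expected_log_likelihood_pos[OF G nondeg[OF sol(2)] pos stat]) simp
      with m sq_ln 1 show ?thesis by blast
    next
      case 2
      have "integrable M (\<lambda>w. 1 + 2 * norm (G w) + (norm (G w))\<^sup>2)"
        using int_norm sq by simp
      moreover have "(\<lambda>w. (nrm (G w))\<^sup>2) = (\<lambda>w. 1 + 2 * norm (G w) + (norm (G w))\<^sup>2)"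
        by (simp add: nrm_def power2_sum fun_eq_iff)
      moreover have "\<mu> nrm = 1 + expectation (\<lambda>w. norm (G w))"
        unfolding \<mu>_def nrm_def using int_norm by (simp add: prob_space)
      moreover have "0 \<le> expectation (\<lambda>w. norm (G w))" by simp
      moreover have "nrm \<in> borel_measurable borel" unfolding nrm_def by measurable
      ultimately show ?thesis using 2 by (simp add: add_pos_nonneg)
    next
      case 3
      have A_borel[measurable]: "A \<in> sets borel" using A(3) 3 by blast
      have "\<mu> (ind A) = expectation (indicator {w \<in> space M. G w \<in> A})"
        unfolding \<mu>_def ind_def
        by (intro Bochner_Integration.integral_cong) (auto simp: indicator_def)
      also have "\<dots> = prob {w \<in> space M. G w \<in> A}" by simp
      finally have "0 < \<mu> (ind A)" using A(3) 3 by simp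
      moreover have "ind A \<in> borel_measurable borel" unfolding ind_def by measurable
      moreover have "integrable M (\<lambda>w. (ind A (G w))\<^sup>2)"
        unfolding ind_def
        by (rule integrable_const_bound[where B = 1]) (auto simp: indicator_def)
      ultimately show ?thesis using 3 by simp
    qed
    then show "f \<in> borel_measurable borel" "integrable M (\<lambda>w. (f (G w))\<^sup>2)" "0 < \<mu> f" by blast+
  qed
  \<comment> \<open>The tolerance is half the mean: outside these events sample means lie between
    one half and three halves of \<open>\<mu> f\<close>, whence the constants \<open>p\<close>,
    \<open>l\<close> and \<open>m\<close>.\<close>
  define B where "B f n = {w \<in> space M. \<bar>(\<Sum>i<n. f (Gs i w)) - real n * \<mu> f\<bar> \<ge> real n * (\<mu> f / 2)}"
    for f n
  define p where "p = Min (insert 1 ((\<lambda>A. \<mu> (ind A) / 2) ` \<A>))"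
  have indF: "ind A \<in> F" if "A \<in> \<A>" for A using that by (simp add: F_def)
  have "0 < p"
    unfolding p_def using A(1) F(3)[OF indF] by (auto simp: Min_gr_iff)
  moreover have "p \<le> \<mu> (ind A) / 2" if "A \<in> \<A>" for A
    unfolding p_def using A(1) that by (intro Min_le) auto
  ultimately have p: "0 < p" "\<And>A. A \<in> \<A> \<Longrightarrow> p \<le> \<mu> (ind A) / 2" by blast+
  have lnF: "lnf \<in> F" and nrmF: "nrm \<in> F" by (simp_all add: F_def)
  define l where "l = \<mu> lnf / 2"
  define m where "m = 3 * \<mu> nrm / 2"
  have lm: "0 < l" "0 < m" using F(3)[OF lnF] F(3)[OF nrmF] by (simp_all add: l_def m_def)
  \<comment> \<open>The threshold \<open>\<eta> * (l / m)\<close> combines the directional margin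
    with the lower bound for the length of the multiplier.\<close>
  obtain b where b: "0 < b" "\<And>u. 0 < u \<Longrightarrow> \<eta> * (l / m) \<le> \<bar>u - 1\<bar> \<Longrightarrow> b \<le> \<phi> u / u"
    using Phi_ratio_lower_bound[OF phi, of "\<eta> * (l / m)"] lm A(2) by (metis divide_pos_pos mult_pos_pos)
  \<comment> \<open>This is the guaranteed growth of the statistic per observation, so
    \<open>n > c / K\<close> suffices.\<close>
  define K where "K = 2 / deriv (deriv \<phi>) 1 * (p * b)"
  have K: "0 < K" using phi p b by (simp add: K_def Phi_def)
  \<comment> \<open>Almost sure positivity is a property of the law, hence passes to every copy, and
    countably many null sets combine.\<close>
  have pos_all: "AE w in M. \<forall>i. 0 < 1 + \<tau> \<bullet> Gs i w"
    unfolding AE_all_countable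
  proof
    fix i
    have "AE x in distr M borel (Gs i). 0 < 1 + \<tau> \<bullet> x"
      unfolding copies using pos by (subst AE_distr_iff) measurable
    then show "AE w in M. 0 < 1 + \<tau> \<bullet> Gs i w"
      by (subst (asm) AE_distr_iff) measurable
  qed
  show ?thesis
  proof (rule tendsto_prob_1I[of F B])
    show "finite F" using A(1) by (simp add: F_def)
    show "B f n \<in> events" if "f \<in> F" for f n
      using F(1)[OF that] unfolding B_def by measurable
    show "{w \<in> space M. c < phi_stat \<phi> n (\<lambda>i. Gs i w)} \<in> events" for n
    proof -
      \<comment> \<open>The event is the preimage of a Borel set of sequences in the product
        topology.\<close>
      have "(\<lambda>w i. Gs i w) \<in> borel_measurable M"
        by (rule measurable_coordinatewise_then_product) measurable
      from measurable_sets[OF this borel_phi_stat_gt[OF Phi_continuous_on[OF phi]], of c n]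
      show ?thesis by (simp add: vimage_def Int_def conj_commute)
    qed
    show "(\<lambda>n. prob (B f n)) \<longlonglongrightarrow> 0" if "f \<in> F" for f
      unfolding B_def \<mu>_def
      using F[OF that] by (intro weak_law_identically_distributed[OF indep G copies]) (auto simp: \<mu>_def)
    obtain N :: nat where N: "c / K < real N" using reals_Archimedean2 by blast
    show "\<forall>\<^sub>F n in sequentially. AE w in M.
            (\<forall>f\<in>F. w \<notin> B f n) \<longrightarrow> w \<in> {w \<in> space M. c < phi_stat \<phi> n (\<lambda>i. Gs i w)}"
      using eventually_gt_at_top[of "max 0 N"]
    proof eventually_elim
      case (elim n)
      from pos_all AE_space show ?case
      proof eventually_elim
        case (elim w)
        show ?case
        proof
          assume "\<forall>f\<in>F. w \<notin> B f n"
          then have near: "\<bar>(\<Sum>i<n. f (Gs i w)) - real n * \<mu> f\<bar> < real n * \<mu> f / 2" if "f \<in> F" for f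
            using that elim(2) by (fastforce simp: B_def)
          have "2 / deriv (deriv \<phi>) 1 * (real n * (p * b)) \<le> phi_stat \<phi> n (\<lambda>i. Gs i w)"
          proof (rule phi_stat_lower_bound[OF phi A(2) _ p(1) A(4) _ _ _ lm(1) _ lm(2) b(2) b(1)])
            show "0 < n" using \<open>max 0 N < n\<close> by simp
            show "real n * p \<le> (\<Sum>i<n. indicator A (Gs i w))" if "A \<in> \<A>" for A
            proof -
              have "real n * p \<le> real n * (\<mu> (ind A) / 2)"
                using p(2)[OF that] by (intro mult_left_mono) auto
              also have "\<dots> \<le> (\<Sum>i<n. ind A (Gs i w))"
                using near[OF indF[OF that]] unfolding abs_less_iff by (simp add: field_simps)
              finally show ?thesis by (simp add: ind_def)
            qed
            show "0 < 1 + \<tau> \<bullet> Gs i w" for i using elim(1) by blast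
            show "real n * l \<le> (\<Sum>i<n. ln (1 + \<tau> \<bullet> Gs i w))"
              using near[OF lnF] unfolding abs_less_iff by (simp add: l_def lnf_def field_simps)
            have "(\<Sum>i<n. norm (Gs i w)) \<le> (\<Sum>i<n. nrm (Gs i w))"
              by (intro sum_mono) (simp add: nrm_def)
            also have "\<dots> \<le> real n * m"
              using near[OF nrmF] unfolding abs_less_iff by (simp add: m_def field_simps)
            finally show "(\<Sum>i<n. norm (Gs i w)) \<le> real n * m" .
          qed
          moreover have "c < real n * K"
          proof -
            have "c < real N * K" using N K by (simp add: field_simps)
            also have "\<dots> \<le> real n * K" using K \<open>max 0 N < n\<close> by (intro mult_right_mono) auto
            finally show ?thesis .
          qed
          ultimately show "w \<in> {w \<in> space M. c < phi_stat \<phi> n (\<lambda>i. Gs i w)}"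
            using elim(2) by (simp add: K_def ac_simps)
        qed
      qed
    qed
  qed
qed

section \<open>Quadratic forms and application to the logistic score\<close>

text \<open>Linearity in \<open>A\<close> lets the quadratic form pass through integrals of
  matrices.\<close>

lemma bounded_linear_quadratic_form:
  "bounded_linear (\<lambda>A :: real ^ 'q ^ 'q. v \<bullet> (A *v v))"
  unfolding linear_conv_bounded_linear[symmetric]
  by (rule linearI)
     (simp_all add: matrix_vector_mult_add_rdistrib inner_add_right scaleR_matrix_vector_assoc[symmetric])

lemma inner_outer: "v \<bullet> (outer x *v v) = (v \<bullet> x)\<^sup>2"
proof -
  have "outer x *v v = (v \<bullet> x) *\<^sub>R x"
    by (simp add: outer_def vec_eq_iff matrix_vector_mult_def matrix_matrix_mult_def rowvector_def
        columnvector_def inner_vec_def sum_distrib_left ac_simps)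
  then show ?thesis by (simp add: power2_eq_square)
qed

lemma borel_measurable_score:
  "(\<lambda>p. score (fst p) (snd p) b) \<in> borel_measurable borel"
  unfolding score_def logistic_def
  by (intro borel_measurable_continuous_onI continuous_intros) (simp add: add_pos_pos less_imp_neq[symmetric])

text \<open>Sample conditions are imposed almost surely for all large \<open>n\<close>, since rank
  \<open>q\<close> is impossible for fewer than \<open>q\<close> observations. Conditions that name
  no parameter value are read at \<open>\<beta>0\<close>. As \<open>\<phi>\<close> lives on the
  positive half-line, existence of the expectation in \<open>iii\<close> includes almost sure
  positivity of its argument, and integrability is stated on that event.\<close>

theorem mainTheorem4:
  fixes M :: "'w measure"
    and X :: "'w \<Rightarrow> real ^ 'q" and Y :: "'w \<Rightarrow> real"
    and Xs :: "nat \<Rightarrow> 'w \<Rightarrow> real ^ 'q" and Ys :: "nat \<Rightarrow> 'w \<Rightarrow> real"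
    and \<beta>s \<beta>0 \<tau> :: "real ^ 'q" and \<phi> :: "real \<Rightarrow> real" and \<alpha> :: real
  assumes prob: "prob_space M"
    and X_meas: "X \<in> borel_measurable M" and Y_meas: "Y \<in> borel_measurable M"
    and Y_binary: "\<forall>w\<in>space M. Y w \<in> {0, 1}"
    and indep: "prob_space.indep_vars M (\<lambda>_. borel) (\<lambda>i w. (Xs i w, Ys i w)) UNIV"
    and copies: "\<And>i. distr M borel (\<lambda>w. (Xs i w, Ys i w)) = distr M borel (\<lambda>w. (X w, Y w))"
    and model: "logistic_model M X Y \<beta>s"
    and design_rank: "AE w in M. \<forall>\<^sub>F n in sequentially. dim ((\<lambda>i. Xs i w) ` {..<n}) = CARD('q)"
    and C1: "\<And>\<beta>. (integrable M (\<lambda>w. score (X w) (Y w) \<beta>) \<and>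
                   integral\<^sup>L M (\<lambda>w. score (X w) (Y w) \<beta>) = 0) \<longleftrightarrow> \<beta> = \<beta>s"
    and C2: "AE w in M. \<forall>\<^sub>F n in sequentially.
               0 \<in> convex hull ((\<lambda>i. score (Xs i w) (Ys i w) \<beta>0) ` {..<n})"
    and C3: "AE w in M. \<forall>\<^sub>F n in sequentially.
               posdef (\<Sum>i<n. outer (score (Xs i w) (Ys i w) \<beta>0))"
    and C4: "integrable M (\<lambda>w. outer (score (X w) (Y w) \<beta>0))"
            "posdef (integral\<^sup>L M (\<lambda>w. outer (score (X w) (Y w) \<beta>0)))"
    and C5: "\<exists>U. open U \<and> \<beta>s \<in> U \<and>
               (AE w in M. score (X w) (Y w) differentiable_on U \<and>
                           continuous_on U (score_jac (X w) (Y w)))"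
    and C6: "\<exists>U G1. open U \<and> \<beta>s \<in> U \<and> G1 \<in> borel_measurable borel \<and>
               integrable M (\<lambda>w. G1 (X w, Y w)) \<and>
               (AE w in M. \<forall>\<beta>\<in>U. norm (score_jac (X w) (Y w) \<beta>) \<le> G1 (X w, Y w) \<and>
                                 norm (score (X w) (Y w) \<beta>) ^ 3 \<le> G1 (X w, Y w))"
    and C7: "integrable M (\<lambda>w. score_jac (X w) (Y w) \<beta>0)"
            "rank (integral\<^sup>L M (\<lambda>w. score_jac (X w) (Y w) \<beta>0)) = CARD('q)"
    and C8: "\<exists>U. open U \<and> \<beta>s \<in> U \<and>
               (AE w in M. score_jac (X w) (Y w) differentiable_on U \<and>
                           continuous_on U (score_hess (X w) (Y w)))"
    and C9: "\<exists>U G2. open U \<and> \<beta>s \<in> U \<and> G2 \<in> borel_measurable borel \<and>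
               integrable M (\<lambda>w. G2 (X w, Y w)) \<and>
               (AE w in M. \<forall>\<beta>\<in>U. norm (score_hess (X w) (Y w) \<beta>) \<le> G2 (X w, Y w))"
    and alternative: "\<beta>s \<noteq> \<beta>0"
    and phi: "\<phi> \<in> Phi"
    and i: "pop_solution M (\<lambda>w. score (X w) (Y w) \<beta>0) \<tau>"
           "\<And>t. pop_solution M (\<lambda>w. score (X w) (Y w) \<beta>0) t \<Longrightarrow> t = \<tau>"
    and ii: "integrable M (\<lambda>w. - (1 / (1 + \<tau> \<bullet> score (X w) (Y w) \<beta>0)\<^sup>2) *\<^sub>R
                                 outer (score (X w) (Y w) \<beta>0))"
            "rank (integral\<^sup>L M (\<lambda>w. - (1 / (1 + \<tau> \<bullet> score (X w) (Y w) \<beta>0)\<^sup>2) *\<^sub>R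
                                 outer (score (X w) (Y w) \<beta>0))) = CARD('q)"
    and iii: "AE w in M. 0 < 1 + \<tau> \<bullet> score (X w) (Y w) \<beta>0"
             "set_integrable M {w \<in> space M. 0 < 1 + \<tau> \<bullet> score (X w) (Y w) \<beta>0}
                (\<lambda>w. (psi \<phi> (1 + \<tau> \<bullet> score (X w) (Y w) \<beta>0) / (1 + \<tau> \<bullet> score (X w) (Y w) \<beta>0))
                      *\<^sub>R score (X w) (Y w) \<beta>0)"
    and level: "0 < \<alpha>" "\<alpha> < 1"
  shows "(\<lambda>n. measure M {w \<in> space M.
             phi_stat \<phi> n (\<lambda>i. score (Xs i w) (Ys i w) \<beta>0) > chi_square_crit CARD('q) \<alpha>})
           \<longlonglongrightarrow> 1"
proof -
  interpret prob_space M by (rule prob)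
  define G where "G w = score (X w) (Y w) \<beta>0" for w
  define Gs where "Gs i w = score (Xs i w) (Ys i w) \<beta>0" for i w
  note score_borel = borel_measurable_score[of \<beta>0]
  have XY: "(\<lambda>w. (X w, Y w)) \<in> borel_measurable M"
    using X_meas Y_meas by (rule borel_measurable_Pair)
  have XYs: "(\<lambda>w. (Xs i w, Ys i w)) \<in> borel_measurable M" for i
    using indep unfolding indep_vars_def by blast
  have G: "G \<in> borel_measurable M"
    using measurable_compose[OF XY score_borel] by (simp add: G_def[abs_def])
  have "indep_vars (\<lambda>_. borel) (\<lambda>i w. score (fst (Xs i w, Ys i w)) (snd (Xs i w, Ys i w)) \<beta>0) UNIV"
    by (rule indep_vars_compose2[OF indep, where Y = "\<lambda>_ p. score (fst p) (snd p) \<beta>0"]) (rule score_borel)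
  then have indep_G: "indep_vars (\<lambda>_. borel) Gs UNIV" by (simp add: Gs_def[abs_def])
  have copies_G: "distr M borel (Gs i) = distr M borel G" for i
  proof -
    have "distr M borel (Gs i) = distr (distr M borel (\<lambda>w. (Xs i w, Ys i w))) borel
            (\<lambda>p. score (fst p) (snd p) \<beta>0)"
      by (subst distr_distr[OF score_borel XYs]) (simp add: Gs_def[abs_def] comp_def)
    also have "\<dots> = distr M borel G"
      unfolding copies by (subst distr_distr[OF score_borel XY]) (simp add: G_def[abs_def] comp_def)
    finally show ?thesis .
  qed
  \<comment> \<open>The quadratic form of the matrix in \<open>C4\<close> at \<open>v\<close> is the
    second moment of \<open>v \<bullet> G\<close>.\<close>
  have sq_inner: "integrable M (\<lambda>w. (v \<bullet> G w)\<^sup>2)"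
    and mean_sq_inner: "expectation (\<lambda>w. (v \<bullet> G w)\<^sup>2) = v \<bullet> (expectation (\<lambda>w. outer (G w)) *v v)" for v
    using integrable_bounded_linear[OF bounded_linear_quadratic_form C4(1), of v]
      integral_bounded_linear[OF bounded_linear_quadratic_form C4(1), of v]
    by (simp_all add: inner_outer G_def)
  have "integrable M (\<lambda>w. \<Sum>b\<in>Basis. (b \<bullet> G w)\<^sup>2)"
    using sq_inner by simp
  moreover have "(norm x)\<^sup>2 = (\<Sum>b\<in>Basis. (b \<bullet> x)\<^sup>2)" for x :: "real ^ 'q"
    unfolding power2_norm_eq_inner by (subst euclidean_inner) (simp add: power2_eq_square inner_commute)
  ultimately have sq: "integrable M (\<lambda>w. (norm (G w))\<^sup>2)" by simp
  have nondeg: "\<not> (AE w in M. v \<bullet> G w = 0)" if "v \<noteq> 0" for v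
  proof
    assume "AE w in M. v \<bullet> G w = 0"
    then have "expectation (\<lambda>w. (v \<bullet> G w)\<^sup>2) = 0"
      by (intro integral_eq_zero_AE) (auto elim: eventually_mono)
    then have "v \<bullet> (expectation (\<lambda>w. outer (G w)) *v v) = 0" using mean_sq_inner by simp
    moreover have "0 < v \<bullet> (expectation (\<lambda>w. outer (G w)) *v v)"
      using C4(2) that unfolding posdef_def G_def by blast
    ultimately show False by simp
  qed
  have sol: "pop_solution M G \<tau>" using i(1) by (simp add: G_def[abs_def])
  \<comment> \<open>At \<open>\<tau> = 0\<close> the population equation would say that
    \<open>G\<close> has mean zero, which \<open>C1\<close> reserves for the true parameter.\<close>
  have "\<tau> \<noteq> 0"
  proof
    assume "\<tau> = 0"
    then have "integrable M G" "integral\<^sup>L M G = 0" using sol by (simp_all add: pop_solution_def)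
    then have "\<beta>0 = \<beta>s" using C1[of \<beta>0] by (simp add: G_def[abs_def])
    with alternative show False by simp
  qed
  \<comment> \<open>The quadratic form of the matrix in \<open>ii\<close> at \<open>\<tau>\<close>
    is minus the square whose integrability \<open>sq2\<close> asserts.\<close>
  have "integrable M (\<lambda>w. \<tau> \<bullet> ((- (1 / (1 + \<tau> \<bullet> G w)\<^sup>2) *\<^sub>R outer (G w)) *v \<tau>))"
    using integrable_bounded_linear[OF bounded_linear_quadratic_form ii(1), of \<tau>] by (simp add: G_def)
  then have "integrable M (\<lambda>w. - ((\<tau> \<bullet> G w) / (1 + \<tau> \<bullet> G w))\<^sup>2)"
    unfolding scaleR_matrix_vector_assoc[symmetric] inner_scaleR_right inner_outer
    by (simp add: power_divide)
  then have sq2: "integrable M (\<lambda>w. ((\<tau> \<bullet> G w) / (1 + \<tau> \<bullet> G w))\<^sup>2)"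
    by simp
  have "AE w in M. 0 < 1 + \<tau> \<bullet> G w" using iii(1) by (simp add: G_def)
  \<comment> \<open>Every fixed threshold is eventually exceeded with probability near one; here it
    is the chi-square critical value.\<close>
  from phi_stat_diverges[OF indep_G G copies_G sq nondeg this sol \<open>\<tau> \<noteq> 0\<close> sq2 phi]
  show ?thesis by (simp add: Gs_def)
qed

end
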